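(* Let $n\geqslant 2$ and $d\geqslant 1$. With respect to the standard basis $\{E_{ij}\mid 1\leqslant i,j\leqslant n\}$ of $\mathfrak{gl}_n(\mathbb{C})$, with variable $x_{ij}$ assigned to $E_{ij}$, the coefficient algebra $B_{\mathfrak{gl}_n(\mathbb{C})}(S^d(\mathbb{C}^n))\subseteq\mathbb{C}[x_{ij}\mid 1\leqslant i,j\leqslant n]$ is equal to the invariant ring $\mathbb{C}[x_{ij}\mid 1\leqslant i,j\leqslant n]^{\mathrm{GL}_n(\mathbb{C})}$ of the conjugation action of $\mathrm{GL}_n(\mathbb{C})$ on $\mathfrak{gl}_n(\mathbb{C})$, i.e. to $\mathbb{C}[s_1,\dots,s_n]=\mathbb{C}[\mathrm{Tr}_1,\dots,\mathrm{Tr}_n]$, where $X=(x_{ij})$ is the generic matrix, $s_i$ is the sum of all principal $i\times i$ minors of $X$, and $\mathrm{Tr}_i=\mathrm{Tr}(X^i)$.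
   Context: Let $\mathfrak{g}$ be a finite-dimensional Lie algebra over a field $k$ with a fixed basis $\{g_1,\dots,g_N\}$, and $V$ an $m$-dimensional representation; write $[g]$ for the matrix of $g\in\mathfrak g$ acting on $V$. The characteristic polynomial of $\mathfrak g$ on $V$ is $\varphi_{\mathfrak g}(V)=\det(x_0 I+\sum_{l} y_l[g_l])$, where $x_0$ and one variable $y_l$ per basis element are indeterminates. Writing $\varphi_{\mathfrak g}(V)=x_0^m+c_1x_0^{m-1}+\cdots+c_m$ with $c_i$ polynomials in the $y_l$, the coefficient algebra $B_{\mathfrak g}(V)$ is the $k$-subalgebra generated by $c_1,\dots,c_m$. $E_{ij}$ denotes the matrix unit. $\mathbb{C}^n$ is the standard representation of $\mathfrak{gl}_n(\mathbb{C})$ with standard basis $e_1,\dots,e_n$, and $S^d(\mathbb{C}^n)$ its $d$-th symmetric power with action $g\cdot(e_{i_1}\cdots e_{i_d})=\sum_{s=1}^d e_{i_1}\cdots g(e_{i_s})\cdots e_{i_d}$. $\mathrm{GL}_n(\mathbb{C})$ acts on $\mathfrak{gl}_n(\mathbb C)$ by $A\mapsto gAg^{-1}$, inducing an action on the coordinate ring $\mathbb{C}[x_{ij}]$. *)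

theory Defs
  imports "HOL-Analysis.Analysis" "HOL-Library.Multiset"
          "HOL-Computational_Algebra.Polynomial"
begin

definition det_on :: "'i set \<Rightarrow> ('i \<Rightarrow> 'i \<Rightarrow> 'a::comm_ring_1) \<Rightarrow> 'a" where
  "det_on I A = (\<Sum>p | p permutes I. of_int (sign p) * (\<Prod>i\<in>I. A i (p i)))"

inductive_set alg_gen :: "('a \<Rightarrow> complex) set \<Rightarrow> ('a \<Rightarrow> complex) set" for S where
  const: "(\<lambda>_. c) \<in> alg_gen S"
| gen: "f \<in> S \<Longrightarrow> f \<in> alg_gen S"
| add: "f \<in> alg_gen S \<Longrightarrow> g \<in> alg_gen S \<Longrightarrow> (\<lambda>x. f x + g x) \<in> alg_gen S"
| mult: "f \<in> alg_gen S \<Longrightarrow> g \<in> alg_gen S \<Longrightarrow> (\<lambda>x. f x * g x) \<in> alg_gen S"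

text \<open>The coordinate ring C[x_ij], realised as polynomial functions on gl_n(C).\<close>
definition poly_funs :: "(complex^'n^'n \<Rightarrow> complex) set" where
  "poly_funs = alg_gen {(\<lambda>X. X $ i $ j) | i j. True}"

definition conj_invariants :: "(complex^'n^'n \<Rightarrow> complex) set" where
  "conj_invariants = {f \<in> poly_funs. \<forall>g X. invertible g \<longrightarrow> f (g ** X ** matrix_inv g) = f X}"

text \<open>Basis of S^d(C^n): monomials e_{i1}...e_{id}, i.e. multisets of size d over the index type.\<close>
definition symbasis :: "nat \<Rightarrow> 'n::finite multiset set" where
  "symbasis d = {M. size M = d}"

text \<open>Matrix of g acting on S^d(C^n): g(e_{i1}...e_{id}) = sum_s e_{i1}..g(e_{is})..e_{id},
  with g(e_j) = sum_i g_ij e_i.  Entry (N, M) = coefficient of basis monomial N in g(M).\<close>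
definition sym_rep :: "complex^'n^'n \<Rightarrow> 'n multiset \<Rightarrow> 'n multiset \<Rightarrow> complex" where
  "sym_rep g N M = (\<Sum>j\<in>UNIV. of_nat (count M j) *
       (\<Sum>i\<in>UNIV. g $ i $ j * (if N = M - {#j#} + {#i#} then 1 else 0)))"

definition sym_charpoly :: "nat \<Rightarrow> complex^'n^'n \<Rightarrow> complex poly" where
  "sym_charpoly d X = det_on (symbasis d)
     (\<lambda>N M. (if N = M then [:0, 1:] else 0) + [: sym_rep X N M :])"

definition sym_coeff :: "nat \<Rightarrow> nat \<Rightarrow> complex^'n^'n \<Rightarrow> complex" where
  "sym_coeff d k X = coeff (sym_charpoly d X) (card (symbasis d :: 'n multiset set) - k)"

definition coeff_algebra_sym :: "nat \<Rightarrow> (complex^'n^'n \<Rightarrow> complex) set" where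
  "coeff_algebra_sym d = alg_gen {sym_coeff d k | k. 1 \<le> k \<and> k \<le> card (symbasis d :: 'n multiset set)}"

definition princ_minor_sum :: "nat \<Rightarrow> complex^'n^'n \<Rightarrow> complex" where
  "princ_minor_sum i X = (\<Sum>I | I \<subseteq> (UNIV::'n set) \<and> card I = i. det_on I (\<lambda>a b. X $ a $ b))"

fun mat_pow :: "'a::semiring_1^'n^'n \<Rightarrow> nat \<Rightarrow> 'a^'n^'n" where
  "mat_pow X 0 = mat 1"
| "mat_pow X (Suc k) = X ** mat_pow X k"

definition power_trace :: "nat \<Rightarrow> complex^'n^'n \<Rightarrow> complex" where
  "power_trace i X = trace (mat_pow X i)"

end

theory Submission
  imports Defs "Jordan_Normal_Form.Schur_Decomposition"
begin

text \<open>A conjugation invariant polynomial is determined by its values on diagonal matrices: every matrix is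
  conjugate to an upper triangular one, and conjugating with a one-parameter torus degenerates that one to
  its diagonal part. On diagonal matrices invariants become symmetric polynomials of the eigenvalues, hence
  polynomials in the power sums \<open>p\<^sub>k\<close>. So a set of invariants generates all of them as soon as
  its restrictions to the diagonal generate the \<open>p\<^sub>k\<close>; for principal minors and traces this
  is Newton's identities. The coefficients for the symmetric power restrict to the elementary symmetric
  functions of the weights, so by Newton they generate the power sums \<open>P\<^sub>k\<close> of the weights, and
  \<open>P\<^sub>k = a p\<^sub>k +\<close> (a polynomial in lower power sums) with \<open>a > 0\<close>, by a recursion over the
  degree \<open>d\<close> all of whose coefficients are positive.\<close>

no_notation Matrix.vec_index (infixl "$" 100)

section \<open>Subalgebras generated by sets of functions\<close>

lemma alg_gen_smult: "f \<in> alg_gen S \<Longrightarrow> (\<lambda>x. c * f x) \<in> alg_gen S"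
  by (rule alg_gen.mult[OF alg_gen.const])

lemma alg_gen_diff:
  assumes "f \<in> alg_gen S" "g \<in> alg_gen S"
  shows "(\<lambda>x. f x - g x) \<in> alg_gen S"
  using alg_gen.add[OF assms(1) alg_gen_smult[OF assms(2), of "-1"]] by simp

lemma alg_gen_sum:
  assumes "\<And>i. i \<in> I \<Longrightarrow> f i \<in> alg_gen S"
  shows "(\<lambda>x. \<Sum>i\<in>I. f i x) \<in> alg_gen S"
  using assms by (induction I rule: infinite_finite_induct)
    (auto intro: alg_gen.const alg_gen.add)

lemma alg_gen_prod:
  assumes "\<And>i. i \<in> I \<Longrightarrow> f i \<in> alg_gen S"
  shows "(\<lambda>x. \<Prod>i\<in>I. f i x) \<in> alg_gen S"
  using assms by (induction I rule: infinite_finite_induct)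
    (auto intro: alg_gen.const alg_gen.mult)

lemma alg_gen_least:
  assumes "S \<subseteq> alg_gen T"
  shows "alg_gen S \<subseteq> alg_gen T"
proof
  fix f assume "f \<in> alg_gen S"
  then show "f \<in> alg_gen T"
    by induction (use assms in \<open>auto intro: alg_gen.const alg_gen.add alg_gen.mult\<close>)
qed

lemma alg_gen_mono: "S \<subseteq> T \<Longrightarrow> alg_gen S \<subseteq> alg_gen T"
  by (rule alg_gen_least) (auto intro: alg_gen.gen)

text \<open>Composition with \<open>D\<close> is an algebra homomorphism, so it maps a generated
  algebra onto the algebra generated by the images. With \<open>D = diagm\<close> this lifts an
  expression found on diagonal matrices to all matrices.\<close>

lemma alg_gen_lift:
  assumes "h \<in> alg_gen ((\<lambda>f. f \<circ> D) ` S)"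
  shows "\<exists>f\<in>alg_gen S. f \<circ> D = h"
  using assms
proof induction
  case (const c)
  then show ?case by (intro bexI[OF _ alg_gen.const[of c]]) auto
next
  case (gen f)
  then show ?case by (auto intro: alg_gen.gen)
next
  case (add f g)
  then obtain f' g' where "f' \<in> alg_gen S" "g' \<in> alg_gen S" "f' \<circ> D = f" "g' \<circ> D = g" by blast
  then show ?case by (intro bexI[OF _ alg_gen.add[of f' S g']]) auto
next
  case (mult f g)
  then obtain f' g' where "f' \<in> alg_gen S" "g' \<in> alg_gen S" "f' \<circ> D = f" "g' \<circ> D = g" by blast
  then show ?case by (intro bexI[OF _ alg_gen.mult[of f' S g']]) auto
qed

subsection \<open>Newton's identities\<close>

definition esym :: "'b set \<Rightarrow> nat \<Rightarrow> ('b \<Rightarrow> complex) \<Rightarrow> complex" where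
  "esym I k y = (\<Sum>S | S \<subseteq> I \<and> card S = k. \<Prod>i\<in>S. y i)"

definition psum :: "'b set \<Rightarrow> nat \<Rightarrow> ('b \<Rightarrow> complex) \<Rightarrow> complex" where
  "psum I k y = (\<Sum>i\<in>I. y i ^ k)"

text \<open>The hook-shaped sums that make Newton's identities telescope:
  e_(k+1) p_j = r(k+1, j) + r(k, j+1) and (k+1) e_(k+1) = r(k, 1).\<close>
definition rsum :: "'b set \<Rightarrow> nat \<Rightarrow> nat \<Rightarrow> ('b \<Rightarrow> complex) \<Rightarrow> complex" where
  "rsum I k j y = (\<Sum>S | S \<subseteq> I \<and> card S = k. \<Sum>i\<in>I - S. y i ^ j * (\<Prod>i\<in>S. y i))"

lemma card_zero_subsets: "finite I \<Longrightarrow> {S. S \<subseteq> I \<and> card S = 0} = {{}}"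
  by (auto simp: card_eq_0_iff dest: finite_subset)

lemma rsum_0: "finite I \<Longrightarrow> rsum I 0 j y = psum I j y"
  by (simp add: rsum_def psum_def card_zero_subsets)

text \<open>A pair (S, i) with i in S corresponds to the pair (S - {i}, i). The factor
  \<open>y i\<close> leaves the product over S and raises the power of \<open>y i\<close> by
  one.\<close>

lemma rsum_shift:
  assumes "finite I"
  shows "(\<Sum>S | S \<subseteq> I \<and> card S = Suc k. \<Sum>i\<in>S. y i ^ j * (\<Prod>i\<in>S. y i)) = rsum I k (Suc j) y"
proof -
  have fin: "finite S" if "S \<subseteq> I" for S
    using that assms finite_subset by blast
  have "(\<Sum>S | S \<subseteq> I \<and> card S = Suc k. \<Sum>i\<in>S. y i ^ j * (\<Prod>i\<in>S. y i)) =
    (\<Sum>(S,i)\<in>(SIGMA S:{S. S \<subseteq> I \<and> card S = Suc k}. S). y i ^ j * (\<Prod>i\<in>S. y i))"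
    using assms fin by (subst sum.Sigma) auto
  also have "\<dots> = (\<Sum>(S,i)\<in>(SIGMA S:{S. S \<subseteq> I \<and> card S = k}. I - S). y i ^ Suc j * (\<Prod>i\<in>S. y i))"
    by (rule sum.reindex_bij_witness[of _ "\<lambda>(S,i). (insert i S, i)" "\<lambda>(S,i). (S - {i}, i)"])
      (auto simp: fin insert_absorb prod.remove)
  also have "\<dots> = rsum I k (Suc j) y"
    unfolding rsum_def using assms fin by (subst sum.Sigma) auto
  finally show ?thesis .
qed

text \<open>The two summands collect the pairs (S, i) with i outside S and with i inside S; the
  latter are rewritten by \<open>rsum_shift\<close>.\<close>

lemma esym_mult_psum:
  assumes "finite I"
  shows "esym I (Suc k) y * psum I j y = rsum I (Suc k) j y + rsum I k (Suc j) y"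
proof -
  have "esym I (Suc k) y * psum I j y =
      (\<Sum>S | S \<subseteq> I \<and> card S = Suc k. \<Sum>i\<in>I. y i ^ j * (\<Prod>i\<in>S. y i))"
    unfolding esym_def psum_def sum_product by (simp add: mult.commute)
  also have "\<dots> = (\<Sum>S | S \<subseteq> I \<and> card S = Suc k. (\<Sum>i\<in>I - S. y i ^ j * (\<Prod>i\<in>S. y i)) +
      (\<Sum>i\<in>S. y i ^ j * (\<Prod>i\<in>S. y i)))"
    by (intro sum.cong refl sum.subset_diff) (use assms in auto)
  also have "\<dots> = rsum I (Suc k) j y + rsum I k (Suc j) y"
    using rsum_shift[OF assms] by (simp add: sum.distrib rsum_def)
  finally show ?thesis .
qed

lemma Suc_mult_esym:
  assumes "finite I"
  shows "of_nat (Suc k) * esym I (Suc k) y = rsum I k 1 y"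
proof -
  have "of_nat (Suc k) * esym I (Suc k) y =
    (\<Sum>S | S \<subseteq> I \<and> card S = Suc k. \<Sum>i\<in>S. y i ^ 0 * (\<Prod>i\<in>S. y i))"
    unfolding esym_def sum_distrib_left by (intro sum.cong) auto
  then show ?thesis using rsum_shift[OF assms, where k = k and j = 0 and y = y] by simp
qed

lemma esym_0: "finite I \<Longrightarrow> esym I 0 y = 1"
  by (simp add: esym_def card_zero_subsets)

lemma esym_eq_0:
  assumes "finite I" "card I < k"
  shows "esym I k y = 0"
proof -
  have "{S. S \<subseteq> I \<and> card S = k} = {}"
    using card_mono[OF assms(1)] assms(2) by (auto simp: not_le[symmetric])
  then show ?thesis unfolding esym_def by (simp only: sum.empty)
qed

text \<open>Newton's identities solved for e_k: k e_k = r(k-1, 1), and repeated use of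
  \<open>esym_mult_psum\<close> lowers the first index of r until r(0, j) = p_j. Division by k uses
  characteristic zero.\<close>

lemma esym_in_alg_gen:
  assumes I: "finite I"
    and P: "\<And>j. 1 \<le> j \<Longrightarrow> j \<le> k \<Longrightarrow> (\<lambda>v. psum I j (\<lambda>i. x i v)) \<in> alg_gen S"
  shows "(\<lambda>v. esym I k (\<lambda>i. x i v)) \<in> alg_gen S"
  using P
proof (induction k rule: less_induct)
  case (less k)
  show ?case
  proof (cases k)
    case 0
    then show ?thesis using I by (simp add: esym_0 alg_gen.const)
  next
    case (Suc m)
    \<comment> \<open>The bound \<open>l + j \<le> k\<close> with \<open>j \<ge> 1\<close> ensures
      that only e_i with i < k and p_i with i \<le> k occur on the way down.\<close>
    have R: "(\<lambda>v. rsum I l j (\<lambda>i. x i v)) \<in> alg_gen S" if "1 \<le> j" "l + j \<le> k" for l j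
      using that
    proof (induction l arbitrary: j)
      case 0
      then show ?case using less.prems[of j] I by (simp add: rsum_0)
    next
      case (Suc l)
      have "(\<lambda>v. esym I (Suc l) (\<lambda>i. x i v)) \<in> alg_gen S"
        by (rule less.IH) (use Suc.prems less.prems in auto)
      moreover have "(\<lambda>v. psum I j (\<lambda>i. x i v)) \<in> alg_gen S"
        by (rule less.prems) (use Suc.prems in auto)
      moreover have "(\<lambda>v. rsum I l (Suc j) (\<lambda>i. x i v)) \<in> alg_gen S"
        by (rule Suc.IH) (use Suc.prems in auto)
      ultimately have "(\<lambda>v. esym I (Suc l) (\<lambda>i. x i v) * psum I j (\<lambda>i. x i v)
          - rsum I l (Suc j) (\<lambda>i. x i v)) \<in> alg_gen S"
        by (intro alg_gen_diff alg_gen.mult)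
      then show ?case by (simp add: esym_mult_psum[OF I])
    qed
    have "(\<lambda>v. inverse (of_nat k) * rsum I m 1 (\<lambda>i. x i v)) \<in> alg_gen S"
      by (intro alg_gen_smult R) (use Suc in auto)
    moreover have "inverse (of_nat k) * rsum I m 1 y = esym I k y" for y
      unfolding Suc_mult_esym[OF I, symmetric] Suc
      by (metis (no_types) Suc_neq_Zero mult.assoc mult_1 left_inverse of_nat_eq_0_iff)
    ultimately show ?thesis by simp
  qed
qed

text \<open>Newton's identities in the other direction: start from r(m, 1) = (m+1) e_(m+1) and move
  along r(m-l, l+1) to r(0, m+1) = p_(m+1).\<close>

lemma psum_in_alg_gen:
  assumes I: "finite I"
    and E: "\<And>j. 1 \<le> j \<Longrightarrow> j \<le> card I \<Longrightarrow> (\<lambda>v. esym I j (\<lambda>i. x i v)) \<in> alg_gen S"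
  shows "(\<lambda>v. psum I k (\<lambda>i. x i v)) \<in> alg_gen S"
proof (induction k rule: less_induct)
  case (less k)
  \<comment> \<open>All e_j become available, since e_0 = 1 and e_j = 0 beyond
    \<open>card I\<close>. Hence power sums of every degree are reached, not only those up to
    \<open>card I\<close>.\<close>
  have E': "(\<lambda>v. esym I j (\<lambda>i. x i v)) \<in> alg_gen S" for j
    using E[of j] esym_0[OF I] esym_eq_0[OF I, of j] alg_gen.const
    by (cases "j = 0"; cases "j \<le> card I") auto
  show ?case
  proof (cases k)
    case 0
    then show ?thesis by (simp add: psum_def alg_gen.const)
  next
    case (Suc m)
    have "(\<lambda>v. rsum I (m - l) (Suc l) (\<lambda>i. x i v)) \<in> alg_gen S" if "l \<le> m" for l
      using that
    proof (induction l)
      case 0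
      show ?case
        using alg_gen_smult[OF E'[of "Suc m"], of "of_nat (Suc m)"]
        unfolding Suc_mult_esym[OF I] by simp
    next
      case (Suc l)
      have eq: "m - l = Suc (m - Suc l)" using Suc.prems by auto
      have "(\<lambda>v. psum I (Suc l) (\<lambda>i. x i v)) \<in> alg_gen S"
        by (rule less) (use Suc.prems \<open>k = Suc m\<close> in auto)
      then have "(\<lambda>v. esym I (m - l) (\<lambda>i. x i v) * psum I (Suc l) (\<lambda>i. x i v)
          - rsum I (m - l) (Suc l) (\<lambda>i. x i v)) \<in> alg_gen S"
        using Suc by (intro alg_gen_diff alg_gen.mult E') auto
      then show ?case unfolding eq esym_mult_psum[OF I] by simp
    qed
    from this[of m] show ?thesis using Suc I by (simp add: rsum_0)
  qed
qed

subsection \<open>Symmetric polynomials in characteristic zero\<close>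

text \<open>Induction on the support S. In the product of the power sum of degree \<open>a s\<close>
  with the symmetrised monomial on S, the new index either lies outside S, which gives the monomial
  on \<open>insert s S\<close>, or meets some i in S, which merges the two exponents. Merging
  changes \<open>a\<close>, so the induction is over all exponents; solving for the new monomial
  divides by the number of indices outside S.\<close>

lemma sum_permutations_monomial_in_alg_gen:
  fixes a :: "'n::finite \<Rightarrow> nat"
  shows "(\<lambda>l. \<Sum>p | p permutes UNIV. \<Prod>i\<in>S. l (p i) ^ a i) \<in> alg_gen (range (psum (UNIV::'n set)))"
proof -
  have "finite S" by simp
  then show ?thesis
  proof (induction S arbitrary: a rule: finite_induct)
    case empty
    then show ?case by (simp add: alg_gen.const)
  next
    case (insert s S)
    let ?P = "{p. p permutes (UNIV::'n set)}"
    let ?m = "\<lambda>S a l. \<Sum>p\<in>?P. \<Prod>i\<in>S. (l::'n \<Rightarrow> complex) (p i) ^ a i"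
    let ?c = "card (UNIV - S)"
    have c: "?c \<noteq> 0" using insert by (auto simp: card_eq_0_iff)
    have eq: "psum UNIV (a s) l * ?m S a l =
        (\<Sum>i\<in>S. ?m S (a(i := a i + a s)) l) + of_nat ?c * ?m (insert s S) a l" for l
    proof -
      have "psum UNIV (a s) l * ?m S a l =
        (\<Sum>p\<in>?P. (\<Sum>i\<in>UNIV. l (p i) ^ a s) * (\<Prod>i\<in>S. l (p i) ^ a i))"
        unfolding sum_distrib_left
      proof (intro sum.cong refl arg_cong2[of _ _ _ _ "(*)"])
        fix p assume "p \<in> ?P"
        then have "bij p" by (simp add: permutes_bij)
        then show "psum UNIV (a s) l = (\<Sum>i\<in>UNIV. l (p i) ^ a s)"
          unfolding psum_def using sum.reindex_bij_betw[of p UNIV UNIV "\<lambda>i. l i ^ a s"] by simp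
      qed
      also have "\<dots> = (\<Sum>i\<in>UNIV. \<Sum>p\<in>?P. l (p i) ^ a s * (\<Prod>i\<in>S. l (p i) ^ a i))"
        unfolding sum_distrib_right by (rule sum.swap)
      also have "\<dots> = (\<Sum>i\<in>UNIV - S. \<Sum>p\<in>?P. l (p i) ^ a s * (\<Prod>i\<in>S. l (p i) ^ a i))
          + (\<Sum>i\<in>S. \<Sum>p\<in>?P. l (p i) ^ a s * (\<Prod>i\<in>S. l (p i) ^ a i))"
        by (rule sum.subset_diff) auto
      also have "(\<Sum>i\<in>UNIV - S. \<Sum>p\<in>?P. l (p i) ^ a s * (\<Prod>i\<in>S. l (p i) ^ a i)) =
          (\<Sum>i\<in>UNIV - S. ?m (insert s S) a l)"
      proof (rule sum.cong[OF refl])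
        fix i assume i: "i \<in> UNIV - S"
        \<comment> \<open>Precomposing every permutation with the swap of i and s fixes S pointwise,
          so each i outside S contributes the same sum as s.\<close>
        have "Transposition.transpose i s permutes UNIV" by (simp add: permutes_swap_id)
        then have "(\<Sum>p\<in>?P. l (p i) ^ a s * (\<Prod>i\<in>S. l (p i) ^ a i)) =
          (\<Sum>p\<in>?P. l ((p \<circ> Transposition.transpose i s) i) ^ a s *
            (\<Prod>j\<in>S. l ((p \<circ> Transposition.transpose i s) j) ^ a j))"
          by (rule sum_permutations_compose_right)
        also have "\<dots> = (\<Sum>p\<in>?P. l (p s) ^ a s * (\<Prod>j\<in>S. l (p j) ^ a j))"
        proof (intro sum.cong refl arg_cong2[of _ _ _ _ "(*)"] prod.cong)
          fix p j assume "j \<in> S"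
          then have "j \<noteq> i" "j \<noteq> s" using i insert by auto
          then show "l ((p \<circ> Transposition.transpose i s) j) ^ a j = l (p j) ^ a j" by simp
        qed simp
        also have "\<dots> = ?m (insert s S) a l" using insert by simp
        finally show "(\<Sum>p\<in>?P. l (p i) ^ a s * (\<Prod>i\<in>S. l (p i) ^ a i)) = ?m (insert s S) a l" .
      qed
      also have "(\<Sum>i\<in>S. \<Sum>p\<in>?P. l (p i) ^ a s * (\<Prod>i\<in>S. l (p i) ^ a i)) =
          (\<Sum>i\<in>S. ?m S (a(i := a i + a s)) l)"
      proof (intro sum.cong[OF refl])
        fix i p assume "i \<in> S"
        then have "S = insert i (S - {i})" by auto
        then show "l (p i) ^ a s * (\<Prod>i\<in>S. l (p i) ^ a i) =
            (\<Prod>j\<in>S. l (p j) ^ (a(i := a i + a s)) j)"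
          using prod.remove[of S i "\<lambda>j. l (p j) ^ (a(i := a i + a s)) j"]
            prod.remove[of S i "\<lambda>i. l (p i) ^ a i"] insert(1) \<open>i \<in> S\<close>
          by (simp add: power_add mult_ac cong: prod.cong_simp)
      qed
      finally show ?thesis by simp
    qed
    have "(\<lambda>l. inverse (of_nat ?c) * (psum UNIV (a s) l * ?m S a l -
        (\<Sum>i\<in>S. ?m S (a(i := a i + a s)) l))) \<in> alg_gen (range (psum (UNIV::'n set)))"
      by (intro alg_gen_smult alg_gen_diff alg_gen.mult alg_gen_sum insert.IH alg_gen.gen) auto
    moreover have "inverse (of_nat ?c) * (psum UNIV (a s) l * ?m S a l -
        (\<Sum>i\<in>S. ?m S (a(i := a i + a s)) l)) = ?m (insert s S) a l" for l
      unfolding eq using c by simp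
    ultimately show ?case by simp
  qed
qed

text \<open>Symmetrisation is not multiplicative, so the induction over \<open>h\<close> carries a second factor \<open>w\<close>.\<close>
lemma symmetric_in_alg_gen_psum:
  assumes h: "h \<in> alg_gen (range (\<lambda>i (l::'n::finite \<Rightarrow> complex). l i))"
    and sym: "\<And>p l. p permutes UNIV \<Longrightarrow> h (\<lambda>i. l (p i)) = h l"
  shows "h \<in> alg_gen (range (psum (UNIV::'n set)))"
proof -
  let ?P = "{p. p permutes (UNIV::'n set)}"
  let ?A = "alg_gen (range (psum (UNIV::'n set)))"
  let ?s = "\<lambda>w a l. \<Sum>p\<in>?P. (\<Prod>i\<in>UNIV. l (p i) ^ a i) * w (\<lambda>i. l (p i))"
  have *: "\<forall>a. ?s (\<lambda>l. h l * w l) a \<in> ?A" if "\<And>a. ?s w a \<in> ?A" for w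
    using h that
  proof (induction arbitrary: w)
    case (const c)
    show ?case
    proof
      fix a
      show "?s (\<lambda>l. c * w l) a \<in> ?A"
        using alg_gen_smult[OF const(1)[of a], of c]
        by (simp add: sum_distrib_left mult_ac)
    qed
  next
    case (gen f)
    then obtain j where f: "f = (\<lambda>l. l j)" by auto
    show ?case
    proof
      fix a
      \<comment> \<open>A coordinate factor is absorbed into the monomial by raising its exponent at
        j, which is why the claim ranges over all \<open>a\<close>.\<close>
      have "(\<Prod>i\<in>UNIV. l (p i) ^ (a(j := Suc (a j))) i) = (\<Prod>i\<in>UNIV. l (p i) ^ a i) * l (p j)"
        for p and l :: "'n \<Rightarrow> complex"
        using prod.remove[of UNIV j "\<lambda>i. l (p i) ^ (a(j := Suc (a j))) i"]
            prod.remove[of UNIV j "\<lambda>i. l (p i) ^ a i"]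
        by (simp add: mult_ac cong: prod.cong_simp)
      then show "?s (\<lambda>l. f l * w l) a \<in> ?A"
        using gen(2)[of "a(j := Suc (a j))"] unfolding f by (simp only: mult.assoc)
    qed
  next
    case (add f g)
    show ?case
    proof
      fix a
      show "?s (\<lambda>l. (f l + g l) * w l) a \<in> ?A"
        using alg_gen.add[OF add.IH(1)[OF add.prems, rule_format] add.IH(2)[OF add.prems, rule_format], of a a]
        by (simp add: algebra_simps sum.distrib)
    qed
  next
    case (mult f g)
    have "\<forall>a. ?s (\<lambda>l. g l * w l) a \<in> ?A" by (rule mult.IH(2)[OF mult.prems])
    then have "\<forall>a. ?s (\<lambda>l. f l * (g l * w l)) a \<in> ?A" by (intro mult.IH(1)) blast
    then show ?case by (simp only: mult.assoc simp_thms)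
  qed
  have "\<forall>a. ?s (\<lambda>l. h l * 1) a \<in> ?A"
    by (rule *) (simp only: mult_1_right sum_permutations_monomial_in_alg_gen)
  \<comment> \<open>With all exponents zero, the symmetrisation of the symmetric function
    \<open>h\<close> is n! times \<open>h\<close>, and n! is invertible.\<close>
  then have "?s (\<lambda>l. h l * 1) (\<lambda>_. 0) \<in> ?A" by (rule spec)
  then have "?s h (\<lambda>_. 0) \<in> ?A" by (simp only: mult_1_right)
  moreover have "?s h (\<lambda>_. 0) l = fact CARD('n) * h l" for l
    using sym card_permutations[of "UNIV::'n set" "CARD('n)"] by simp
  ultimately have "(\<lambda>l. fact CARD('n) * h l) \<in> ?A" by simp
  from alg_gen_smult[OF this, of "inverse (fact CARD('n))"] show ?thesis
    by (simp add: mult.assoc[symmetric])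
qed

subsection \<open>Power sums of the weights of the symmetric power\<close>

lemma finite_symbasis [simp]: "finite (symbasis d :: 'n::finite multiset set)"
proof (induction d)
  case 0
  then show ?case by (simp add: symbasis_def)
next
  case (Suc d)
  have "symbasis (Suc d) \<subseteq> (\<Union>i::'n. add_mset i ` symbasis d)"
  proof
    fix M :: "'n multiset" assume "M \<in> symbasis (Suc d)"
    then have "size M = Suc d" by (simp add: symbasis_def)
    moreover from this obtain i N where "M = add_mset i N" using size_eq_Suc_imp_eq_union by blast
    ultimately show "M \<in> (\<Union>i. add_mset i ` symbasis d)" by (auto simp: symbasis_def)
  qed
  then show ?case by (rule finite_subset) (simp add: Suc)
qed

text \<open>The eigenvalue of the diagonal matrix with entries \<open>l\<close> on the basis
  monomial \<open>M\<close>; see \<open>sym_rep_diagm\<close>.\<close>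

definition weight :: "('n \<Rightarrow> complex) \<Rightarrow> 'n multiset \<Rightarrow> complex" where
  "weight l M = (\<Sum>i\<in>#M. l i)"

text \<open>Both sides count triples (M, i, r) with 1 \<le> r \<le> M(i), since the multiplicities of M add up to d.
  This is the identity d h_d = \<Sum>_r p_r h_(d-r) evaluated at exponentials.\<close>
lemma sum_symbasis_count:
  fixes F :: "'n::finite multiset \<Rightarrow> complex"
  shows "of_nat d * (\<Sum>M\<in>symbasis d. F M) =
    (\<Sum>r\<in>{1..d}. \<Sum>i\<in>UNIV. \<Sum>M\<in>symbasis (d - r). F (M + replicate_mset r i))"
proof -
  have "of_nat d * (\<Sum>M\<in>symbasis d. F M) =
      (\<Sum>M\<in>symbasis d. \<Sum>r\<in>{1..d}. \<Sum>i\<in>UNIV. if r \<le> count M i then F M else 0)"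
    unfolding sum_distrib_left
  proof (intro sum.cong refl)
    fix M :: "'n multiset" assume "M \<in> symbasis d"
    then have d: "size M = d" by (simp add: symbasis_def)
    have "(\<Sum>r\<in>{1..d}. \<Sum>i\<in>UNIV. if r \<le> count M i then F M else 0) =
        (\<Sum>i\<in>UNIV. \<Sum>r\<in>{1..d}. if r \<le> count M i then F M else 0)"
      by (rule sum.swap)
    also have "\<dots> = (\<Sum>i\<in>UNIV. of_nat (count M i) * F M)"
    proof (intro sum.cong refl)
      fix i
      have "count M i \<le> d" using d count_le_size by metis
      then have "{1..d} \<inter> {r. r \<le> count M i} = {1..count M i}" by auto
      then show "(\<Sum>r\<in>{1..d}. if r \<le> count M i then F M else 0) = of_nat (count M i) * F M"
        by (simp add: sum.If_cases)
    qed
    also have "\<dots> = of_nat (\<Sum>i\<in>UNIV. count M i) * F M"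
      by (simp add: sum_distrib_right)
    also have "(\<Sum>i\<in>UNIV. count M i) = d"
      unfolding d[symmetric] size_multiset_overloaded_eq
      by (rule sum.mono_neutral_right) (auto simp: not_in_iff)
    finally show "of_nat d * F M = (\<Sum>r\<in>{1..d}. \<Sum>i\<in>UNIV. if r \<le> count M i then F M else 0)" by simp
  qed
  also have "\<dots> = (\<Sum>r\<in>{1..d}. \<Sum>M\<in>symbasis d. \<Sum>i\<in>UNIV. if r \<le> count M i then F M else 0)"
    by (rule sum.swap)
  also have "\<dots> = (\<Sum>r\<in>{1..d}. \<Sum>i\<in>UNIV. \<Sum>M\<in>symbasis d. if r \<le> count M i then F M else 0)"
    by (intro sum.cong refl sum.swap)
  also have "\<dots> = (\<Sum>r\<in>{1..d}. \<Sum>i\<in>UNIV. \<Sum>M\<in>symbasis (d - r). F (M + replicate_mset r i))"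
  proof (rule sum.cong[OF refl], rule sum.cong[OF refl])
    fix r and i :: 'n assume r: "r \<in> {1..d}"
    have "(\<Sum>M\<in>symbasis d. if r \<le> count M i then F M else 0) =
        (\<Sum>M\<in>{M \<in> symbasis d. r \<le> count M i}. F M)"
      by (simp add: sum.inter_filter)
    also have "\<dots> = (\<Sum>M\<in>symbasis (d - r). F (M + replicate_mset r i))"
      by (rule sum.reindex_bij_witness[of _ "\<lambda>M. M + replicate_mset r i" "\<lambda>M. M - replicate_mset r i"])
        (use r in \<open>auto simp: symbasis_def count_le_replicate_mset_subset_eq size_Diff_submset\<close>)
    finally show "(\<Sum>M\<in>symbasis d. if r \<le> count M i then F M else 0) =
      (\<Sum>M\<in>symbasis (d - r). F (M + replicate_mset r i))" .
  qed
  finally show ?thesis .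
qed

text \<open>Apply \<open>sum_symbasis_count\<close> to the k-th power of the weight. Adding r copies
  of i to M adds \<open>r * l i\<close> to its weight, so the binomial theorem separates the sum
  over i from the sum over M.\<close>

lemma psum_symbasis_rec:
  fixes l :: "'n::finite \<Rightarrow> complex"
  shows "of_nat d * psum (symbasis d) k (weight l) =
    (\<Sum>r\<in>{1..d}. \<Sum>t\<le>k. of_nat ((k choose t) * r ^ t) * psum UNIV t l *
        psum (symbasis (d - r)) (k - t) (weight l))"
proof -
  have "(\<Sum>i\<in>UNIV. \<Sum>M\<in>symbasis (d - r). weight l (M + replicate_mset r i) ^ k) =
    (\<Sum>t\<le>k. of_nat ((k choose t) * r ^ t) * psum UNIV t l * psum (symbasis (d - r)) (k - t) (weight l))" for r
  proof -
    have "(\<Sum>i\<in>UNIV. \<Sum>M\<in>symbasis (d - r). weight l (M + replicate_mset r i) ^ k) =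
      (\<Sum>i\<in>UNIV. \<Sum>M\<in>symbasis (d - r). \<Sum>t\<le>k. of_nat ((k choose t) * r ^ t) * (l i ^ t * weight l M ^ (k - t)))"
    proof (intro sum.cong refl)
      fix i and M :: "'n multiset"
      have w: "weight l (M + replicate_mset r i) = of_nat r * l i + weight l M"
        by (simp add: weight_def)
      show "weight l (M + replicate_mset r i) ^ k =
        (\<Sum>t\<le>k. of_nat ((k choose t) * r ^ t) * (l i ^ t * weight l M ^ (k - t)))"
        unfolding w binomial_ring by (simp add: power_mult_distrib mult_ac)
    qed
    also have "\<dots> = (\<Sum>i\<in>UNIV. \<Sum>t\<le>k. \<Sum>M\<in>symbasis (d - r). of_nat ((k choose t) * r ^ t) * (l i ^ t * weight l M ^ (k - t)))"
      by (intro sum.cong refl sum.swap)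
    also have "\<dots> = (\<Sum>t\<le>k. \<Sum>i\<in>UNIV. \<Sum>M\<in>symbasis (d - r). of_nat ((k choose t) * r ^ t) * (l i ^ t * weight l M ^ (k - t)))"
      by (rule sum.swap)
    also have "\<dots> = (\<Sum>t\<le>k. of_nat ((k choose t) * r ^ t) * psum UNIV t l * psum (symbasis (d - r)) (k - t) (weight l))"
      by (simp only: psum_def mult.assoc sum_product) (simp only: sum_distrib_left)
    finally show ?thesis .
  qed
  then show ?thesis
    unfolding psum_def[of "symbasis d"] sum_symbasis_count by simp
qed

lemma symbasis_nonempty: "symbasis d \<noteq> {}"
proof -
  have "replicate_mset d undefined \<in> symbasis d" by (simp add: symbasis_def)
  then show ?thesis by blast
qed

text \<open>In \<open>psum_symbasis_rec\<close>, only t = 0 and t = k contribute to the coefficient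
  of p_k modulo lower power sums. This gives d a_d = sum over r of (n a_(d-r) + r^k |symbasis
  (d-r)|), which is positive for d \<ge> 1. For d = 0 the coefficient is zero, so the induction
  carries only \<open>a \<ge> 0\<close> there.\<close>

lemma psum_symbasis_leading_term:
  assumes "k \<ge> 1"
  shows "\<exists>a::real. a \<ge> 0 \<and> (d \<ge> 1 \<longrightarrow> a > 0) \<and>
    (\<lambda>l. psum (symbasis d) k (weight l) - of_real a * psum UNIV k l)
      \<in> alg_gen {psum (UNIV::'n::finite set) j | j. 1 \<le> j \<and> j < k}"
  using assms
proof (induction d arbitrary: k rule: less_induct)
  case (less d)
  let ?L = "\<lambda>k. alg_gen {psum (UNIV::'n set) j | j. 1 \<le> j \<and> j < k}"
  let ?W = "\<lambda>d k l. psum (symbasis d) k (weight (l::'n \<Rightarrow> complex))"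
  let ?p = "psum (UNIV::'n set)"
  have p: "?p t \<in> ?L k" if "1 \<le> t" "t < k" for t
    by (rule alg_gen.gen) (use that in auto)
  have W: "?W e t \<in> ?L k" if "e < d" "t < k" for e t
  proof (cases "t = 0")
    case True
    then show ?thesis by (simp add: psum_def alg_gen.const)
  next
    case False
    then obtain a where "(\<lambda>l. ?W e t l - of_real a * ?p t l) \<in> ?L t"
      using less.IH[OF \<open>e < d\<close>, of t] by auto
    moreover have "?L t \<subseteq> ?L k" by (rule alg_gen_mono) (use that in auto)
    ultimately have "(\<lambda>l. (?W e t l - of_real a * ?p t l) + of_real a * ?p t l) \<in> ?L k"
      by (intro alg_gen.add alg_gen_smult p) (use that False in auto)
    then show ?thesis by simp
  qed
  show ?case
  proof (cases "d = 0")
    case True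
    \<comment> \<open>The only monomial of degree 0 is empty and has weight 0, so its power sum
      vanishes for k \<ge> 1.\<close>
    then show ?thesis
      using less.prems
      by (intro exI[of _ 0]) (simp add: psum_def symbasis_def weight_def power_0_left alg_gen.const)
  next
    case False
    have "\<forall>r\<in>{1..d}. \<exists>a::real. a \<ge> 0 \<and> (\<lambda>l. ?W (d - r) k l - of_real a * ?p k l) \<in> ?L k"
    proof
      fix r assume "r \<in> {1..d}"
      then have "d - r < d" by auto
      from less.IH[OF this less.prems]
      show "\<exists>a::real. a \<ge> 0 \<and> (\<lambda>l. ?W (d - r) k l - of_real a * ?p k l) \<in> ?L k" by blast
    qed
    from bchoice[OF this] obtain a :: "nat \<Rightarrow> real" where a: "\<And>r. r \<in> {1..d} \<Longrightarrow> a r \<ge> 0"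
      "\<And>r. r \<in> {1..d} \<Longrightarrow> (\<lambda>l. ?W (d - r) k l - of_real (a r) * ?p k l) \<in> ?L k"
      by blast
    \<comment> \<open>The coefficient of p_k in the r-th summand of the recursion: t = 0 gives p_0 =
      n times \<open>a r\<close>, and t = k gives r^k times the number of monomials of degree d -
      r.\<close>
    define b where "b r = CARD('n) * a r + r ^ k * card (symbasis (d - r) :: 'n multiset set)" for r
    define c where "c = (\<Sum>r\<in>{1..d}. b r) / d"
    have b: "b r > 0" if "r \<in> {1..d}" for r
    proof -
      have "card (symbasis (d - r) :: 'n multiset set) > 0"
        using symbasis_nonempty by (simp add: card_gt_0_iff)
      then show ?thesis unfolding b_def using a(1)[OF that] that
        by (intro add_nonneg_pos mult_pos_pos) auto
    qed
    have c: "c > 0" unfolding c_def using False b by (intro divide_pos_pos sum_pos) auto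
    let ?T = "\<lambda>r t l. of_nat ((k choose t) * r ^ t) * ?p t l * ?W (d - r) (k - t) l"
    \<comment> \<open>For 0 < t < k both power sums in \<open>?T r t\<close> have degree below k,
      hence lie in \<open>?L k\<close>.\<close>
    have "(\<lambda>l. inverse (of_nat d) * (\<Sum>r\<in>{1..d}. of_nat CARD('n) * (?W (d - r) k l - of_real (a r) * ?p k l)
        + (\<Sum>t\<in>{1..<k}. ?T r t l))) \<in> ?L k"
      by (intro alg_gen_smult alg_gen_sum alg_gen.add alg_gen.mult alg_gen.const a W p) auto
    moreover have "inverse (of_nat d) * (\<Sum>r\<in>{1..d}. of_nat CARD('n) * (?W (d - r) k l - of_real (a r) * ?p k l)
        + (\<Sum>t\<in>{1..<k}. ?T r t l)) = ?W d k l - of_real c * ?p k l" for l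
    proof -
      have T: "of_nat CARD('n) * (?W (d - r) k l - of_real (a r) * ?p k l) + (\<Sum>t\<in>{1..<k}. ?T r t l) =
         (\<Sum>t\<le>k. ?T r t l) - of_real (b r) * ?p k l" for r
      proof -
        have "{..k} = insert 0 (insert k {1..<k})" using less.prems by auto
        then have "(\<Sum>t\<le>k. ?T r t l) = ?T r 0 l + (?T r k l + (\<Sum>t\<in>{1..<k}. ?T r t l))"
          using less.prems by simp
        then show ?thesis unfolding b_def by (simp add: psum_def algebra_simps)
      qed
      have "(\<Sum>r\<in>{1..d}. of_nat CARD('n) * (?W (d - r) k l - of_real (a r) * ?p k l)
        + (\<Sum>t\<in>{1..<k}. ?T r t l)) = of_nat d * ?W d k l - of_real (\<Sum>r\<in>{1..d}. b r) * ?p k l"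
        unfolding T psum_symbasis_rec by (simp add: sum_subtractf sum_distrib_right)
      also have "(\<Sum>r\<in>{1..d}. b r) = d * c" unfolding c_def using False by simp
      finally show ?thesis using False by (simp add: field_simps)
    qed
    ultimately have "(\<lambda>l. ?W d k l - of_real c * ?p k l) \<in> ?L k" by simp
    then show ?thesis using c by (intro exI[of _ c]) auto
  qed
qed

text \<open>Newton's identities over the set of monomials yield the power sums of the weights. Their
  leading coefficient \<open>a\<close> is nonzero, so the relation can be solved for p_k once the
  lower power sums are known.\<close>

lemma psum_in_alg_gen_esym_symbasis:
  assumes "d \<ge> 1"
    and E: "\<And>j. 1 \<le> j \<Longrightarrow> j \<le> card (symbasis d :: 'n::finite multiset set) \<Longrightarrow>
      (\<lambda>l. esym (symbasis d :: 'n multiset set) j (weight l)) \<in> alg_gen S"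
  shows "psum (UNIV :: 'n set) k \<in> alg_gen S"
proof (induction k rule: less_induct)
  case (less k)
  show ?case
  proof (cases "k = 0")
    case True
    then show ?thesis by (simp add: psum_def[abs_def] alg_gen.const)
  next
    case False
    then obtain a :: real where a: "a > 0"
      "(\<lambda>l. psum (symbasis d) k (weight l) - of_real a * psum (UNIV::'n set) k l)
        \<in> alg_gen {psum UNIV j | j. 1 \<le> j \<and> j < k}"
      using psum_symbasis_leading_term[of k d] assms(1) by auto
    have "alg_gen {psum (UNIV::'n set) j | j. 1 \<le> j \<and> j < k} \<subseteq> alg_gen S"
      by (rule alg_gen_least) (use less in auto)
    moreover have "(\<lambda>l. psum (symbasis d :: 'n multiset set) k (weight l)) \<in> alg_gen S"
      using psum_in_alg_gen[of "symbasis d" "\<lambda>M l. weight l M" S k] E by simp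
    ultimately have P: "(\<lambda>l. inverse (of_real a) * (psum (symbasis d) k (weight l) -
        (psum (symbasis d) k (weight l) - of_real a * psum (UNIV::'n set) k l))) \<in> alg_gen S"
      using alg_gen_smult[OF alg_gen_diff] a(2) by blast
    have "inverse (of_real a) * (psum (symbasis d) k (weight l) -
        (psum (symbasis d) k (weight l) - of_real a * psum (UNIV::'n set) k l)) = psum UNIV k l" for l
      using a(1) by (simp add: field_simps)
    with P show ?thesis by (simp only:)
  qed
qed

subsection \<open>Determinants over finite index sets\<close>

lemma sum_map_permutation:
  assumes f: "bij_betw f A B" and "finite A"
  shows "(\<Sum>p | p permutes B. F p) = (\<Sum>p | p permutes A. F (map_permutation A f p))"
proof -
  have inj: "inj_on f A" and B: "f ` A = B" using f by (auto simp: bij_betw_def)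
  have f': "bij_betw (inv_into A f) B A" using f by (rule bij_betw_inv_into)
  have inj': "inj_on (inv_into A f) B" using f' by (simp add: bij_betw_def)
  show ?thesis
  proof (rule sum.reindex_bij_witness[of _ "map_permutation A f" "map_permutation B (inv_into A f)"])
    fix p assume "p \<in> {p. p permutes B}"
    then have p: "p permutes B" by simp
    show "map_permutation B (inv_into A f) p \<in> {p. p permutes A}"
      using map_permutation_permutes[OF f' p] by simp
    show "map_permutation A f (map_permutation B (inv_into A f) p) = p"
      by (rule map_permutation_compose_inv[OF f' p]) (auto simp: B[symmetric] f_inv_into_f)
    then show "F (map_permutation A f (map_permutation B (inv_into A f) p)) = F p" by simp
  next
    fix p assume "p \<in> {p. p permutes A}"
    then have p: "p permutes A" by simp
    show "map_permutation A f p \<in> {p. p permutes B}"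
      using map_permutation_permutes[OF f p] by simp
    show "map_permutation B (inv_into A f) (map_permutation A f p) = p"
      by (rule map_permutation_compose_inv[OF f p]) (simp add: inj)
  qed
qed

text \<open>Relabelling along \<open>f\<close> conjugates permutations and preserves their signs. An
  enumeration of \<open>I\<close> thus makes multiplicativity of the matrix determinant available
  for arbitrary finite index sets, in particular for sets of multisets.\<close>

lemma det_on_eq_det:
  assumes f: "bij_betw f {0..<m} I"
  shows "det_on I A = Determinant.det (Matrix.mat m m (\<lambda>(i,j). A (f i) (f j)))"
proof -
  have inj: "inj_on f {0..<m}" using f by (simp add: bij_betw_def)
  show ?thesis
    unfolding det_on_def det_def'[OF mat_carrier] sum_map_permutation[OF f finite_atLeastLessThan]
  proof (rule sum.cong[OF refl])
    fix p assume "p \<in> {p. p permutes {0..<m}}"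
    then have p: "p permutes {0..<m}" by simp
    have "(\<Prod>i\<in>I. A i (map_permutation {0..<m} f p i)) =
        (\<Prod>i\<in>{0..<m}. A (f i) (map_permutation {0..<m} f p (f i)))"
      by (rule prod.reindex_bij_betw[OF f, symmetric])
    also have "\<dots> = (\<Prod>i\<in>{0..<m}. A (f i) (f (p i)))"
      by (intro prod.cong refl) (simp add: map_permutation_apply[OF inj])
    also have "\<dots> = (\<Prod>i = 0..<m. Matrix.mat m m (\<lambda>(i,j). A (f i) (f j)) $$ (i, p i))"
      using p by (intro prod.cong refl) (auto dest: permutes_in_image)
    finally show "of_int (sign (map_permutation {0..<m} f p)) * (\<Prod>i\<in>I. A i (map_permutation {0..<m} f p i)) =
        signof p * (\<Prod>i = 0..<m. Matrix.mat m m (\<lambda>(i,j). A (f i) (f j)) $$ (i, p i))"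
      by (simp only: sign_map_permutation[OF inj p finite_atLeastLessThan])
  qed
qed

lemma det_on_mult:
  assumes "finite I"
  shows "det_on I (\<lambda>i j. \<Sum>k\<in>I. A i k * B k j) = det_on I A * det_on I B"
proof -
  obtain f where f: "bij_betw f {0..<card I} I"
    using ex_bij_betw_nat_finite[OF assms] by blast
  let ?M = "\<lambda>A. Matrix.mat (card I) (card I) (\<lambda>(i,j). A (f i) (f j))"
  have "?M (\<lambda>i j. \<Sum>k\<in>I. A i k * B k j) = ?M A * ?M B"
    by (rule eq_matI) (auto simp: scalar_prod_def sum.reindex_bij_betw[OF f, symmetric])
  then show ?thesis
    unfolding det_on_eq_det[OF f] by (simp add: Determinant.det_mult[of _ "card I"])
qed

lemma det_on_cong:
  assumes "\<And>i j. i \<in> I \<Longrightarrow> j \<in> I \<Longrightarrow> A i j = B i j"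
  shows "det_on I A = det_on I B"
  unfolding det_on_def
  by (intro sum.cong refl arg_cong2[of _ _ _ _ "(*)"] prod.cong assms) (auto dest: permutes_in_image)

lemma det_on_diagonal:
  assumes "finite I"
  shows "det_on I (\<lambda>i j. if i = j then a i else 0) = (\<Prod>i\<in>I. a i)"
proof -
  have "det_on I (\<lambda>i j. if i = j then a i else 0) =
      (\<Sum>p\<in>{id}. of_int (sign p) * (\<Prod>i\<in>I. if i = p i then a i else 0))"
    unfolding det_on_def
  proof (rule sum.mono_neutral_right)
    show "\<forall>p\<in>{p. p permutes I} - {id}. of_int (sign p) * (\<Prod>i\<in>I. if i = p i then a i else 0) = 0"
    proof
      fix p assume p: "p \<in> {p. p permutes I} - {id}"
      then obtain i where "i \<noteq> p i" by (metis DiffD2 eq_id_iff insertCI)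
      with p have "i \<in> I" by (auto simp: permutes_def)
      with \<open>i \<noteq> p i\<close> assms have "(\<Prod>i\<in>I. if i = p i then a i else 0) = 0"
        by (intro prod_zero) auto
      then show "of_int (sign p) * (\<Prod>i\<in>I. if i = p i then a i else 0) = 0" by simp
    qed
  qed (use assms in \<open>auto simp: finite_permutations permutes_id\<close>)
  then show ?thesis by simp
qed

subsection \<open>Characteristic polynomials over finite index sets\<close>

definition minor_sum :: "'i set \<Rightarrow> nat \<Rightarrow> ('i \<Rightarrow> 'i \<Rightarrow> complex) \<Rightarrow> complex" where
  "minor_sum I k A = (\<Sum>B | B \<subseteq> I \<and> card B = k. det_on B A)"

text \<open>The matrix xI + A; the plus sign makes the coefficients of its determinant the principal
  minor sums without alternating signs.\<close>

definition char_mat :: "('i \<Rightarrow> 'i \<Rightarrow> complex) \<Rightarrow> 'i \<Rightarrow> 'i \<Rightarrow> complex poly" where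
  "char_mat A i j = (if i = j then [:0, 1:] else 0) + [:A i j:]"

lemma prod_pCons_0: "(\<Prod>i\<in>B. [:a i:]) = [:\<Prod>i\<in>B. (a i :: complex):]"
  by (induction B rule: infinite_finite_induct) (auto simp: one_pCons)

lemma sum_pCons_0: "(\<Sum>i\<in>B. [:a i:]) = [:\<Sum>i\<in>B. (a i :: complex):]"
  by (induction B rule: infinite_finite_induct) auto

text \<open>Expand every product over the set B of positions where the constant entry is chosen. The
  positions outside B contribute diagonal entries x only, so a permutation survives exactly when it
  fixes I - B pointwise, that is, when it permutes B.\<close>

lemma det_on_char_mat:
  assumes I: "finite I"
  shows "det_on I (char_mat A) = (\<Sum>B\<in>Pow I. monom (det_on B A) (card (I - B)))"
proof -
  let ?t = "\<lambda>p B. of_int (sign p) * ((\<Prod>i\<in>B. [:A i (p i):]) *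
      (\<Prod>i\<in>I - B. if i = p i then [:0, 1:] else 0))"
  have "det_on I (char_mat A) = (\<Sum>p | p permutes I. \<Sum>B\<in>Pow I. ?t p B)"
    unfolding det_on_def char_mat_def
    \<comment> \<open>The swap puts the constant summand first, so that in \<open>prod_add\<close>
      the set B indexes the constant entries.\<close>
    by (subst add.commute, subst prod_add[OF I]) (simp add: sum_distrib_left)
  also have "\<dots> = (\<Sum>B\<in>Pow I. \<Sum>p | p permutes I. ?t p B)" by (rule sum.swap)
  also have "\<dots> = (\<Sum>B\<in>Pow I. monom (det_on B A) (card (I - B)))"
  proof (rule sum.cong[OF refl])
    fix B assume "B \<in> Pow I"
    then have B: "B \<subseteq> I" by simp
    have "(\<Sum>p | p permutes I. ?t p B) = (\<Sum>p | p permutes B. ?t p B)"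
    proof (rule sum.mono_neutral_right)
      show "\<forall>p\<in>{p. p permutes I} - {p. p permutes B}. ?t p B = 0"
      proof
        fix p assume p: "p \<in> {p. p permutes I} - {p. p permutes B}"
        then have "\<not> (\<forall>x\<in>I - B. p x = x)" using permutes_superset[of p I B] by blast
        then obtain i where "i \<in> I - B" "i \<noteq> p i" by metis
        then have "(\<Prod>i\<in>I - B. if i = p i then [:0, 1 :: complex:] else 0) = 0"
          using I by (intro prod_zero) auto
        then show "?t p B = 0" by (simp only: mult_zero_right)
      qed
    qed (use I B in \<open>auto simp: finite_permutations intro: permutes_subset\<close>)
    also have "\<dots> = (\<Sum>p | p permutes B. monom (of_int (sign p) * (\<Prod>i\<in>B. A i (p i))) (card (I - B)))"
    proof (rule sum.cong[OF refl])
      fix p assume p: "p \<in> {p. p permutes B}"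
      have "(\<Prod>i\<in>I - B. if i = p i then [:0, 1 :: complex:] else 0) = (\<Prod>i\<in>I - B. [:0, 1:])"
      proof (rule prod.cong[OF refl])
        fix i assume "i \<in> I - B"
        then have "p i = i" using p by (auto intro: permutes_not_in)
        then show "(if i = p i then [:0, 1 :: complex:] else 0) = [:0, 1:]" by simp
      qed
      also have "\<dots> = monom 1 (card (I - B))" by (simp add: monom_altdef)
      finally show "?t p B = monom (of_int (sign p) * (\<Prod>i\<in>B. A i (p i))) (card (I - B))"
        unfolding prod_pCons_0 by (simp add: monom_altdef of_int_poly mult.commute)
    qed
    also have "\<dots> = monom (det_on B A) (card (I - B))"
      unfolding det_on_def by (rule monom_sum[symmetric])
    finally show "(\<Sum>p | p permutes I. ?t p B) = monom (det_on B A) (card (I - B))" .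
  qed
  finally show ?thesis .
qed

text \<open>The bound on \<open>k\<close> makes the truncated difference \<open>card I - k\<close>
  determine \<open>k\<close>, so that exactly the subsets of size \<open>k\<close>
  contribute.\<close>

lemma coeff_det_on_char_mat:
  assumes I: "finite I" and k: "k \<le> card I"
  shows "coeff (det_on I (char_mat A)) (card I - k) = minor_sum I k A"
proof -
  have "coeff (det_on I (char_mat A)) (card I - k) =
      (\<Sum>B\<in>Pow I. if card B = k then det_on B A else 0)"
    unfolding det_on_char_mat[OF I] coeff_sum
  proof (intro sum.cong refl)
    fix B assume "B \<in> Pow I"
    then have "card (I - B) = card I - card B" "card B \<le> card I"
      using I by (auto simp: card_Diff_subset finite_subset card_mono)
    then show "coeff (monom (det_on B A) (card (I - B))) (card I - k) =
        (if card B = k then det_on B A else 0)"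
      using k by auto
  qed
  also have "\<dots> = minor_sum I k A"
    unfolding minor_sum_def using I by (simp add: sum.inter_filter[symmetric])
  finally show ?thesis .
qed

text \<open>From A T = T B follows (xI + A) T = T (xI + B). Taking determinants over the integral
  domain of polynomials, the nonzero factor det T cancels. The intertwining form avoids writing A as
  a conjugate, which suits the induced maps on symmetric powers.\<close>

lemma minor_sum_similar:
  assumes I: "finite I" and k: "k \<le> card I"
    and AT: "\<And>i j. i \<in> I \<Longrightarrow> j \<in> I \<Longrightarrow> (\<Sum>k\<in>I. A i k * T k j) = (\<Sum>k\<in>I. T i k * B k j)"
    and ST: "\<And>i j. i \<in> I \<Longrightarrow> j \<in> I \<Longrightarrow> (\<Sum>k\<in>I. S i k * T k j) = (if i = j then 1 else 0)"
  shows "minor_sum I k A = minor_sum I k B"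
proof -
  let ?T = "\<lambda>i j. [:T i j:]"
  have "det_on I S * det_on I T = 1"
    unfolding det_on_mult[OF I, symmetric] using det_on_diagonal[OF I, of "\<lambda>_. 1"]
    by (subst det_on_cong[OF ST]) auto
  then have "det_on I T \<noteq> 0" by auto
  moreover have "det_on I ?T = [:det_on I T:]"
    by (simp add: det_on_def prod_pCons_0 of_int_poly sum_pCons_0 mult.commute)
  ultimately have T0: "det_on I ?T \<noteq> 0" by simp
  have "(\<Sum>k\<in>I. char_mat A i k * ?T k j) = (\<Sum>k\<in>I. ?T i k * char_mat B k j)"
    if "i \<in> I" "j \<in> I" for i j
  proof -
    have "(\<Sum>k\<in>I. char_mat A i k * ?T k j) =
        (\<Sum>k\<in>I. (if i = k then [:0, 1:] * ?T k j else 0) + [:A i k * T k j:])"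
      by (intro sum.cong refl) (auto simp: char_mat_def distrib_right)
    also have "\<dots> = [:0, 1:] * ?T i j + [:\<Sum>k\<in>I. A i k * T k j:]"
      using I that by (simp add: sum.distrib sum.delta' sum_pCons_0)
    finally have 1: "(\<Sum>k\<in>I. char_mat A i k * ?T k j) = [:0, 1:] * ?T i j + [:\<Sum>k\<in>I. A i k * T k j:]" .
    have "(\<Sum>k\<in>I. ?T i k * char_mat B k j) =
        (\<Sum>k\<in>I. (if k = j then [:0, 1:] * ?T i k else 0) + [:T i k * B k j:])"
      by (intro sum.cong refl) (auto simp: char_mat_def distrib_left)
    also have "\<dots> = [:0, 1:] * ?T i j + [:\<Sum>k\<in>I. T i k * B k j:]"
      using I that by (simp add: sum.distrib sum.delta sum_pCons_0)
    finally show ?thesis using AT[OF that] 1 by simp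
  qed
  then have "det_on I (char_mat A) * det_on I ?T = det_on I ?T * det_on I (char_mat B)"
    unfolding det_on_mult[OF I, symmetric] by (intro det_on_cong)
  then have "det_on I (char_mat A) = det_on I (char_mat B)" using T0 by simp
  then show ?thesis using coeff_det_on_char_mat[OF I k] by metis
qed

subsection \<open>Triangularisation\<close>

definition of_mat :: "('n::finite \<Rightarrow> nat) \<Rightarrow> complex mat \<Rightarrow> complex^'n^'n" where
  "of_mat e A = (\<chi> i j. A $$ (e i, e j))"

lemma of_mat_mult:
  assumes e: "bij_betw e (UNIV::'n::finite set) {0..<n}"
    and "A \<in> carrier_mat n n" "B \<in> carrier_mat n n"
  shows "of_mat e (A * B) = of_mat e A ** of_mat e B"
proof -
  have "e i < n" for i using e by (auto simp: bij_betw_def)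
  then show ?thesis
    using assms(2,3)
    by (auto simp: of_mat_def matrix_matrix_mult_def scalar_prod_def Finite_Cartesian_Product.vec_eq_iff
      sum.reindex_bij_betw[OF e, of "\<lambda>k. A $$ (_, k) * B $$ (k, _)"])
qed

text \<open>The characteristic polynomial splits over the complex numbers, so a Schur decomposition
  exists. The index type carries no order; triangularity therefore refers to the enumeration
  \<open>e\<close>.\<close>

lemma triangularizable:
  fixes X :: "complex^'n::finite^'n"
  obtains e :: "'n \<Rightarrow> nat" and P Q U :: "complex^'n^'n"
  where "inj e" "P ** Q = Finite_Cartesian_Product.mat 1" "Q ** P = Finite_Cartesian_Product.mat 1"
    "X = P ** U ** Q" "\<And>i j. e j < e i \<Longrightarrow> U $ i $ j = 0"
proof -
  let ?n = "CARD('n)"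
  obtain e where e: "bij_betw e (UNIV::'n set) {0..<?n}"
    using ex_bij_betw_finite_nat[of "UNIV::'n set"] by auto
  have lt: "e i < ?n" for i using e by (auto simp: bij_betw_def)
  have inj: "inj e" using e by (simp add: bij_betw_def)
  define A where "A = Matrix.mat ?n ?n (\<lambda>(i,j). X $ inv_into UNIV e i $ inv_into UNIV e j)"
  have A: "A \<in> carrier_mat ?n ?n" by (simp add: A_def)
  obtain es where "char_poly A = (\<Prod>a\<leftarrow>es. [:- a, 1:])" using char_poly_factorized[OF A] by blast
  from schur_decomposition_exists[OF A this]
  obtain B where B: "B \<in> carrier_mat ?n ?n" "upper_triangular B" "similar_mat A B" by blast
  then obtain P Q where PQ: "similar_mat_wit A B P Q" by (auto simp: similar_mat_def)
  note w = similar_mat_witD2[OF A PQ]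
  have X: "of_mat e A = X" by (simp add: A_def of_mat_def Finite_Cartesian_Product.vec_eq_iff lt inj)
  have one: "of_mat e (1\<^sub>m ?n) = Finite_Cartesian_Product.mat 1"
    using inj by (auto simp: of_mat_def Finite_Cartesian_Product.mat_def Finite_Cartesian_Product.vec_eq_iff lt inj_eq)
  show ?thesis
  proof (rule that[of e "of_mat e P" "of_mat e Q" "of_mat e B"])
    show "of_mat e P ** of_mat e Q = Finite_Cartesian_Product.mat 1"
      using of_mat_mult[OF e w(6,7)] one w(1) by simp
    show "of_mat e Q ** of_mat e P = Finite_Cartesian_Product.mat 1"
      using of_mat_mult[OF e w(7,6)] one w(2) by simp
    show "X = of_mat e P ** of_mat e B ** of_mat e Q"
      using of_mat_mult[OF e mult_carrier_mat[OF w(6,5)] w(7)] of_mat_mult[OF e w(6,5)] w(3) X by simp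
    show "of_mat e B $ i $ j = 0" if "e j < e i" for i j
      using B(1,2) that lt[of i] by (auto simp: of_mat_def upper_triangular_def)
  qed (rule inj)
qed

subsection \<open>Restriction of invariants to diagonal matrices\<close>

definition diagm :: "('n \<Rightarrow> complex) \<Rightarrow> complex^'n^'n" where
  "diagm l = (\<chi> i j. if i = j then l i else 0)"

lemma diagm_nth: "diagm l $ i $ j = (if i = j then l i else 0)"
  by (simp add: diagm_def)

lemma diagm_mult: "(diagm l ** X) $ i $ j = l i * X $ i $ j"
  by (simp add: diagm_nth matrix_matrix_mult_def if_distrib[of "\<lambda>x. x * _"] sum.delta cong: if_cong)

lemma mult_diagm: "(X ** diagm l) $ i $ j = X $ i $ j * l j"
  by (simp add: diagm_nth matrix_matrix_mult_def if_distrib[of "\<lambda>x. _ * x"] sum.delta cong: if_cong)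

lemma matrix_inv_eqI:
  fixes P Q :: "complex^'n^'n"
  assumes "P ** Q = Finite_Cartesian_Product.mat 1" "Q ** P = Finite_Cartesian_Product.mat 1"
  shows "matrix_inv P = Q"
proof -
  have "P ** matrix_inv P = Finite_Cartesian_Product.mat 1 \<and> matrix_inv P ** P = Finite_Cartesian_Product.mat 1"
    unfolding matrix_inv_def by (rule someI[of _ Q]) (use assms in simp)
  then show ?thesis using assms
    by (metis matrix_mul_assoc matrix_mul_lid matrix_mul_rid)
qed

lemma conj_invariantsD:
  assumes "f \<in> conj_invariants" "P ** Q = Finite_Cartesian_Product.mat 1" "Q ** P = Finite_Cartesian_Product.mat 1"
  shows "f (P ** X ** Q) = f X"
proof -
  have "invertible P" using assms(2,3) by (auto simp: invertible_def)
  then show ?thesis using assms(1) matrix_inv_eqI[OF assms(2,3)] by (auto simp: conj_invariants_def)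
qed

lemma conj_invariantsI:
  assumes "f \<in> poly_funs"
    and "\<And>P Q X. P ** Q = Finite_Cartesian_Product.mat 1 \<Longrightarrow> Q ** P = Finite_Cartesian_Product.mat 1 \<Longrightarrow>
      f (P ** X ** Q) = f X"
  shows "f \<in> conj_invariants"
  using assms matrix_inv_eqI unfolding conj_invariants_def invertible_def by fastforce

lemma poly_funs_continuous:
  assumes "f \<in> poly_funs"
  shows "continuous_on UNIV f"
  using assms unfolding poly_funs_def
  by induction (auto intro!: continuous_intros)

text \<open>Conjugation by diag(t^(-e i)) scales the entry (i, j) by t^(e j - e i); as t tends to 0 only the diagonal survives.\<close>
lemma conj_invariant_upper_triangular:
  fixes e :: "'n::finite \<Rightarrow> nat" and U :: "complex^'n^'n"
  assumes f: "f \<in> conj_invariants" and e: "inj e"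
    and U: "\<And>i j. e j < e i \<Longrightarrow> U $ i $ j = 0"
  shows "f U = f (diagm (\<lambda>i. U $ i $ i))"
proof -
  \<comment> \<open>A polynomial in t, so t = 0 is allowed. Where \<open>e j < e i\<close> the
    truncated exponent is 0, but there the entry of \<open>U\<close> vanishes.\<close>
  define V :: "complex \<Rightarrow> complex^'n^'n" where "V t = (\<chi> i j. U $ i $ j * t ^ (e j - e i))" for t
  have V: "f (V t) = f U" if "t \<noteq> 0" for t
  proof -
    let ?P = "diagm (\<lambda>i. inverse t ^ e i)" and ?Q = "diagm (\<lambda>i. t ^ e i)"
    have 1: "?P ** ?Q = Finite_Cartesian_Product.mat 1"
      using that by (auto simp: Finite_Cartesian_Product.vec_eq_iff diagm_mult diagm_nth Finite_Cartesian_Product.mat_def power_mult_distrib[symmetric])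
    then have 2: "?Q ** ?P = Finite_Cartesian_Product.mat 1" by (simp add: matrix_left_right_inverse)
    have "V t $ i $ j = (?P ** U ** ?Q) $ i $ j" for i j
    proof (cases "e j < e i")
      case True
      then show ?thesis by (simp add: V_def mult_diagm diagm_mult U)
    next
      case False
      then have "t ^ e j = t ^ e i * t ^ (e j - e i)" by (simp add: power_add[symmetric])
      then show ?thesis using that by (simp add: V_def mult_diagm diagm_mult power_inverse)
    qed
    then have "V t = ?P ** U ** ?Q" by (simp add: Finite_Cartesian_Product.vec_eq_iff)
    then show ?thesis using conj_invariantsD[OF f 1 2] by simp
  qed
  have cV: "continuous_on UNIV V" unfolding V_def by (intro continuous_intros)
  have "f \<in> poly_funs" using f by (simp add: conj_invariants_def)
  from continuous_on_compose2[OF poly_funs_continuous[OF this] cV]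
  have "continuous_on UNIV (\<lambda>t. f (V t))" by simp
  then have "((\<lambda>t. f (V t)) \<longlongrightarrow> f (V 0)) (at 0)"
    by (simp add: continuous_on_def)
  moreover have "((\<lambda>t. f (V t)) \<longlongrightarrow> f U) (at 0)"
    by (rule Lim_transform_eventually[OF tendsto_const]) (auto simp: eventually_at_filter V)
  ultimately have "f (V 0) = f U" by (intro tendsto_unique[of "at (0::complex)"]) auto
  moreover have "V 0 $ i $ j = diagm (\<lambda>i. U $ i $ i) $ i $ j" for i j
  proof (cases "i = j \<or> e j < e i")
    case True
    then show ?thesis by (auto simp: V_def diagm_nth U)
  next
    case False
    then have "e i \<noteq> e j" using injD[OF e, of i j] by blast
    then have "e j - e i \<noteq> 0" using False by auto
    then show ?thesis using False by (simp add: V_def diagm_nth)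
  qed
  then have "V 0 = diagm (\<lambda>i. U $ i $ i)" by (simp add: Finite_Cartesian_Product.vec_eq_iff)
  ultimately show ?thesis by simp
qed

text \<open>The diagonal \<open>l\<close> comes from a triangular form of X and is the same for all
  invariants, so two invariants can be compared at X through their values at
  \<open>diagm l\<close>.\<close>

lemma conj_invariants_diagonalize:
  fixes X :: "complex^'n::finite^'n"
  shows "\<exists>l. \<forall>f\<in>conj_invariants. f X = f (diagm l)"
proof -
  obtain e :: "'n \<Rightarrow> nat" and P Q U :: "complex^'n^'n"
    where "inj e" "P ** Q = Finite_Cartesian_Product.mat 1" "Q ** P = Finite_Cartesian_Product.mat 1"
    "X = P ** U ** Q" "\<And>i j. e j < e i \<Longrightarrow> U $ i $ j = 0"
    using triangularizable[of X] by blast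
  then have "f X = f (diagm (\<lambda>i. U $ i $ i))" if "f \<in> conj_invariants" for f
    using conj_invariantsD[OF that] conj_invariant_upper_triangular[OF that] by metis
  then show ?thesis by blast
qed

lemma alg_gen_subset_conj_invariants:
  assumes "S \<subseteq> conj_invariants"
  shows "alg_gen S \<subseteq> conj_invariants"
proof
  fix f assume f: "f \<in> alg_gen S"
  have "S \<subseteq> poly_funs" using assms by (auto simp: conj_invariants_def)
  then have "f \<in> poly_funs" using f alg_gen_least unfolding poly_funs_def by blast
  moreover from f have "f (P ** X ** Q) = f X"
    if "P ** Q = Finite_Cartesian_Product.mat 1" "Q ** P = Finite_Cartesian_Product.mat 1" for P Q X
    by induction (use assms conj_invariantsD[OF _ that] in auto)
  ultimately show "f \<in> conj_invariants" by (rule conj_invariantsI)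
qed

text \<open>Conjugation by a permutation matrix permutes the diagonal entries.\<close>

lemma conj_invariant_diagm_permute:
  fixes l :: "'n::finite \<Rightarrow> complex"
  assumes "f \<in> conj_invariants" "p permutes UNIV"
  shows "f (diagm (\<lambda>i. l (p i))) = f (diagm l)"
proof -
  define P :: "complex^'n^'n" where "P = (\<chi> i j. if p i = j then 1 else 0)"
  define Q :: "complex^'n^'n" where "Q = (\<chi> i j. if i = p j then 1 else 0)"
  have p: "p i = p j \<longleftrightarrow> i = j" for i j using assms(2) by (metis permutes_def)
  have P: "(P ** X) $ i $ j = X $ p i $ j" for X i j
    by (simp add: P_def matrix_matrix_mult_def if_distrib[of "\<lambda>x. x * _"] sum.delta cong: if_cong)
  have Q: "(X ** Q) $ i $ j = X $ i $ p j" for X i j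
    by (simp add: Q_def matrix_matrix_mult_def if_distrib[of "\<lambda>x. _ * x"] sum.delta cong: if_cong)
  have 1: "P ** Q = Finite_Cartesian_Product.mat 1"
    by (simp add: Finite_Cartesian_Product.vec_eq_iff P) (simp add: Q_def Finite_Cartesian_Product.mat_def p)
  then have 2: "Q ** P = Finite_Cartesian_Product.mat 1" by (simp add: matrix_left_right_inverse)
  have "P ** diagm l ** Q = diagm (\<lambda>i. l (p i))"
    by (simp add: Finite_Cartesian_Product.vec_eq_iff P Q) (simp add: diagm_nth p)
  then show ?thesis using conj_invariantsD[OF assms(1) 1 2] by metis
qed

lemma conj_invariant_comp_diagm:
  fixes f :: "complex^'n::finite^'n \<Rightarrow> complex"
  assumes "f \<in> conj_invariants"
  shows "f \<circ> diagm \<in> alg_gen (range (psum UNIV))"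
proof (rule symmetric_in_alg_gen_psum)
  have "f \<in> poly_funs" using assms by (simp add: conj_invariants_def)
  then show "f \<circ> diagm \<in> alg_gen (range (\<lambda>i (l::'n \<Rightarrow> complex). l i))"
    unfolding poly_funs_def
  proof induction
    case (gen f)
    then obtain i j where f: "f = (\<lambda>X. X $ i $ j)" by blast
    show ?case
      by (cases "i = j") (auto simp: f diagm_nth comp_def intro: alg_gen.const alg_gen.gen)
  qed (auto simp: comp_def intro: alg_gen.const alg_gen.add alg_gen.mult)
  show "(f \<circ> diagm) (\<lambda>i. l (p i)) = (f \<circ> diagm) l" if "p permutes UNIV" for p l
    using conj_invariant_diagm_permute[OF assms that] by simp
qed

text \<open>The restriction of an invariant \<open>f\<close> to the diagonal is a polynomial in
  power sums, hence also the restriction of some \<open>g\<close> in \<open>alg_gen S\<close>. Both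
  are invariants, so agreement on the diagonal forces f = g.\<close>

lemma alg_gen_eq_conj_invariants:
  fixes S :: "(complex^'n::finite^'n \<Rightarrow> complex) set"
  assumes S: "S \<subseteq> conj_invariants"
    and p: "\<And>k. psum UNIV k \<in> alg_gen ((\<lambda>f. f \<circ> diagm) ` S)"
  shows "alg_gen S = conj_invariants"
proof
  show S': "alg_gen S \<subseteq> conj_invariants" by (rule alg_gen_subset_conj_invariants[OF S])
  show "conj_invariants \<subseteq> alg_gen S"
  proof
    fix f :: "complex^'n^'n \<Rightarrow> complex" assume f: "f \<in> conj_invariants"
    have "alg_gen (range (psum UNIV)) \<subseteq> alg_gen ((\<lambda>f. f \<circ> (diagm :: _ \<Rightarrow> complex^'n^'n)) ` S)"
      by (rule alg_gen_least) (use p in auto)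
    then have "f \<circ> diagm \<in> alg_gen ((\<lambda>f. f \<circ> diagm) ` S)"
      using conj_invariant_comp_diagm[OF f] by blast
    then obtain g where g: "g \<in> alg_gen S" "g \<circ> diagm = f \<circ> diagm" using alg_gen_lift by blast
    have "f X = g X" for X
      using conj_invariants_diagonalize[of X] f g S' by (metis comp_apply subsetD)
    then show "f \<in> alg_gen S" using g(1) by (metis ext)
  qed
qed

section \<open>Principal minor sums and power traces as invariants\<close>

lemma det_on_in_alg_gen:
  assumes "\<And>i j. i \<in> I \<Longrightarrow> j \<in> I \<Longrightarrow> (\<lambda>x. A x i j) \<in> alg_gen S"
  shows "(\<lambda>x. det_on I (A x)) \<in> alg_gen S"
  unfolding det_on_def using assms
  by (intro alg_gen_sum alg_gen_smult alg_gen_prod) (auto dest: permutes_in_image)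

lemma minor_sum_in_alg_gen:
  assumes "\<And>i j. i \<in> I \<Longrightarrow> j \<in> I \<Longrightarrow> (\<lambda>x. A x i j) \<in> alg_gen S"
  shows "(\<lambda>x. minor_sum I k (A x)) \<in> alg_gen S"
  unfolding minor_sum_def using assms
  by (intro alg_gen_sum det_on_in_alg_gen) auto

lemma minor_sum_diagonal:
  assumes I: "finite I" and A: "\<And>i j. i \<in> I \<Longrightarrow> j \<in> I \<Longrightarrow> A i j = (if i = j then a i else 0)"
  shows "minor_sum I k A = esym I k a"
  unfolding minor_sum_def esym_def
proof (intro sum.cong refl)
  fix B assume "B \<in> {B. B \<subseteq> I \<and> card B = k}"
  then have "B \<subseteq> I" "finite B" using I finite_subset by auto
  then have "det_on B A = det_on B (\<lambda>i j. if i = j then a i else 0)"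
    by (intro det_on_cong A) auto
  then show "det_on B A = prod a B" using det_on_diagonal[OF \<open>finite B\<close>] by metis
qed

lemma coord_in_poly_funs: "(\<lambda>X. X $ i $ j) \<in> poly_funs"
  unfolding poly_funs_def by (rule alg_gen.gen) auto

lemma princ_minor_sum_eq: "princ_minor_sum k X = minor_sum UNIV k (\<lambda>i j. X $ i $ j)"
  by (simp add: princ_minor_sum_def minor_sum_def)

lemma princ_minor_sum_conj_invariant:
  assumes "k \<le> CARD('n::finite)"
  shows "(princ_minor_sum k :: complex^'n^'n \<Rightarrow> complex) \<in> conj_invariants"
proof (rule conj_invariantsI)
  have "(\<lambda>X::complex^'n^'n. minor_sum UNIV k (\<lambda>i j. X $ i $ j)) \<in> poly_funs"
    unfolding poly_funs_def
    by (intro minor_sum_in_alg_gen coord_in_poly_funs[unfolded poly_funs_def])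
  then show "(princ_minor_sum k :: complex^'n^'n \<Rightarrow> complex) \<in> poly_funs"
    by (simp add: princ_minor_sum_eq[abs_def])
next
  fix P Q X :: "complex^'n^'n"
  assume PQ: "P ** Q = Finite_Cartesian_Product.mat 1" "Q ** P = Finite_Cartesian_Product.mat 1"
  have eq: "(\<Sum>k\<in>UNIV. A $ i $ k * B $ k $ j) = (A ** B) $ i $ j" for A B :: "complex^'n^'n" and i j
    by (simp add: matrix_matrix_mult_def)
  show "princ_minor_sum k (P ** X ** Q) = princ_minor_sum k X"
    unfolding princ_minor_sum_eq
  \<comment> \<open>\<open>P\<close> intertwines the two matrices because P X Q P = P X.\<close>
  proof (rule minor_sum_similar[where T = "\<lambda>i j. P $ i $ j" and S = "\<lambda>i j. Q $ i $ j"])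
    show "(\<Sum>k\<in>UNIV. (P ** X ** Q) $ i $ k * P $ k $ j) = (\<Sum>k\<in>UNIV. P $ i $ k * X $ k $ j)" for i j
      unfolding eq matrix_mul_assoc[symmetric] PQ by simp
    show "(\<Sum>k\<in>UNIV. Q $ i $ k * P $ k $ j) = (if i = j then 1 else 0)" for i j
      unfolding eq PQ by (simp add: Finite_Cartesian_Product.mat_def)
  qed (use assms in auto)
qed

lemma mat_pow_conj:
  assumes "Q ** P = Finite_Cartesian_Product.mat 1" "P ** Q = Finite_Cartesian_Product.mat 1"
  shows "mat_pow (P ** X ** Q) k = P ** mat_pow X k ** Q"
proof (induction k)
  case (Suc k)
  have "P ** X ** Q ** (P ** mat_pow X k ** Q) = P ** X ** (Q ** P) ** mat_pow X k ** Q"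
    by (simp only: matrix_mul_assoc)
  then show ?case using Suc assms by (simp add: matrix_mul_assoc)
qed (simp add: assms)

lemma trace_mult_commute: "trace (A ** B) = trace (B ** (A :: complex^'n^'n))"
  unfolding trace_def matrix_matrix_mult_def by (simp add: mult.commute) (rule sum.swap)

lemma power_trace_conj_invariant: "(power_trace k :: complex^'n^'n \<Rightarrow> complex) \<in> conj_invariants"
proof (rule conj_invariantsI)
  have "(\<lambda>X::complex^'n^'n. mat_pow X k $ i $ j) \<in> poly_funs" for i j
  proof (induction k arbitrary: i j)
    case 0
    show ?case
      by (cases "i = j") (simp_all add: Finite_Cartesian_Product.mat_def poly_funs_def alg_gen.const)
  next
    case (Suc k)
    then show ?case using coord_in_poly_funs
      by (auto simp: matrix_matrix_mult_def poly_funs_def intro!: alg_gen_sum alg_gen.mult)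
  qed
  then show "(power_trace k :: complex^'n^'n \<Rightarrow> complex) \<in> poly_funs"
    by (auto simp: power_trace_def[abs_def] trace_def poly_funs_def intro!: alg_gen_sum)
next
  fix P Q X :: "complex^'n^'n"
  assume PQ: "P ** Q = Finite_Cartesian_Product.mat 1" "Q ** P = Finite_Cartesian_Product.mat 1"
  show "power_trace k (P ** X ** Q) = power_trace k X"
    unfolding power_trace_def mat_pow_conj[OF PQ(2,1)] trace_mult_commute[of _ Q] matrix_mul_assoc PQ
    by simp
qed

lemma mat_pow_diagm: "mat_pow (diagm l) k = diagm (\<lambda>i. l i ^ k)"
  by (induction k) (auto simp: Finite_Cartesian_Product.vec_eq_iff diagm_mult diagm_nth Finite_Cartesian_Product.mat_def)

lemma power_trace_diagm: "power_trace k (diagm l) = psum UNIV k l"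
  by (simp add: power_trace_def mat_pow_diagm trace_def diagm_nth psum_def)

lemma princ_minor_sum_diagm: "princ_minor_sum k (diagm l) = esym UNIV k l"
  unfolding princ_minor_sum_eq by (rule minor_sum_diagonal) (auto simp: diagm_nth)

subsection \<open>Conjugation invariance for the symmetric power\<close>

definition mon_eval :: "'n multiset \<Rightarrow> ('n \<Rightarrow> complex) \<Rightarrow> complex" where
  "mon_eval M v = (\<Prod>i\<in>#M. v i)"

text \<open>Row vector convention: with e_j read as the j-th coordinate function, X(e_j) = sum_i
  X_ij e_i takes the value \<open>vmul v X j\<close> at \<open>v\<close>.\<close>

definition vmul :: "('n::finite \<Rightarrow> complex) \<Rightarrow> complex^'n^'n \<Rightarrow> 'n \<Rightarrow> complex" where
  "vmul v X j = (\<Sum>i\<in>UNIV. v i * X $ i $ j)"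

text \<open>The directional derivative of the monomial \<open>M\<close> at \<open>v\<close> along
  \<open>w\<close>.\<close>

definition dmon_eval :: "'n::finite multiset \<Rightarrow> ('n \<Rightarrow> complex) \<Rightarrow> ('n \<Rightarrow> complex) \<Rightarrow> complex" where
  "dmon_eval M v w = (\<Sum>j\<in>UNIV. of_nat (count M j) * w j * mon_eval (M - {#j#}) v)"

lemma mon_eval_simps [simp]: "mon_eval {#} v = 1" "mon_eval (add_mset i M) v = v i * mon_eval M v"
  by (simp_all add: mon_eval_def)

lemma mon_eval_mult: "mon_eval M (\<lambda>i. v i * w i) = mon_eval M v * mon_eval M w"
  by (induction M) (simp_all add: mult_ac)

lemma mon_eval_eq_prod: "mon_eval M v = (\<Prod>i\<in>(UNIV::'n::finite set). v i ^ count M i)"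
proof (induction M)
  case (add j M)
  have "(\<Prod>i\<in>UNIV. v i ^ count (add_mset j M) i) = (\<Prod>i\<in>UNIV. (if i = j then v i else 1) * v i ^ count M i)"
    by (intro prod.cong) auto
  then show ?case using add by (simp add: prod.distrib prod.delta)
qed simp

text \<open>Monomials are distinct multiplicative characters, so Dedekind's argument applies.\<close>
lemma mon_eval_independent:
  fixes c :: "'n::finite multiset \<Rightarrow> complex"
  assumes "finite F" "\<And>v. (\<Sum>N\<in>F. c N * mon_eval N v) = 0" "N \<in> F"
  shows "c N = 0"
  using assms
proof (induction F arbitrary: c N rule: finite_induct)
  case (insert M F)
  have F: "c N = 0" if "N \<in> F" for N
  proof -
    have "N \<noteq> M" using that insert by auto
    then obtain j where j: "count N j \<noteq> count M j" by (metis multiset_eqI)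
    \<comment> \<open>Doubling the j-th coordinate scales a monomial K by 2 to the power
      \<open>count K j\<close>, which separates N from M.\<close>
    define u :: "'n \<Rightarrow> complex" where "u i = (if i = j then 2 else 1)" for i
    have u: "mon_eval K u = 2 ^ count K j" for K
    proof -
      have "mon_eval K u = (\<Prod>i\<in>UNIV. if i = j then 2 ^ count K i else 1)"
        unfolding mon_eval_eq_prod u_def by (intro prod.cong) auto
      then show ?thesis by (simp add: prod.delta)
    qed
    have "mon_eval N u \<noteq> mon_eval M u"
    proof
      assume "mon_eval N u = mon_eval M u"
      then have "(of_nat (2 ^ count N j) :: complex) = of_nat (2 ^ count M j)" by (simp add: u)
      then have "(2::nat) ^ count N j = 2 ^ count M j" by (simp only: of_nat_eq_iff)
      then show False using j by simp
    qed
    \<comment> \<open>Subtract \<open>mon_eval M u\<close> times the relation at v from the relation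
      at the point u v: the term of M cancels, and the shorter relation over F falls to the
      induction hypothesis.\<close>
    moreover have "c N * (mon_eval N u - mon_eval M u) = 0"
    proof (rule insert.IH[OF _ that])
      fix v
      have "(\<Sum>N\<in>F. c N * (mon_eval N u - mon_eval M u) * mon_eval N v) =
          (\<Sum>N\<in>insert M F. c N * (mon_eval N u - mon_eval M u) * mon_eval N v)"
        using insert by simp
      also have "\<dots> = (\<Sum>N\<in>insert M F. c N * mon_eval N (\<lambda>i. u i * v i)) -
          mon_eval M u * (\<Sum>N\<in>insert M F. c N * mon_eval N v)"
        unfolding mon_eval_mult sum_distrib_left by (simp add: sum_subtractf[symmetric] algebra_simps)
      also have "\<dots> = 0" unfolding insert.prems(1) by simp
      finally show "(\<Sum>N\<in>F. c N * (mon_eval N u - mon_eval M u) * mon_eval N v) = 0" .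
    qed
    ultimately show ?thesis by simp
  qed
  \<comment> \<open>Only the term of M is left, and every monomial equals 1 at the all-ones
    point.\<close>
  moreover have "c M = 0"
    using insert.prems(1)[of "\<lambda>_. 1"] insert(1,2) F by (simp add: mon_eval_eq_prod)
  ultimately show ?case using insert.prems by auto
qed simp

lemma mon_eval_independent_eq:
  fixes c :: "'n::finite multiset \<Rightarrow> complex"
  assumes "\<And>v. (\<Sum>N\<in>symbasis d. c N * mon_eval N v) = (\<Sum>N\<in>symbasis d. c' N * mon_eval N v)"
    and "N \<in> symbasis d"
  shows "c N = c' N"
  using mon_eval_independent[of "symbasis d" "\<lambda>N. c N - c' N" N] assms
  by (simp add: left_diff_distrib sum_subtractf)

text \<open>Substituting linear forms into a monomial preserves its degree. Each further factor j
  turns the coefficients into sums of \<open>g $ i $ j\<close> times the old coefficient of N with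
  one i removed.\<close>

lemma mon_eval_vmul:
  fixes g :: "complex^'n::finite^'n"
  shows "\<exists>c. \<forall>v. mon_eval M (vmul v g) = (\<Sum>N\<in>symbasis (size M). c N * mon_eval N v)"
proof (induction M)
  case empty
  have "symbasis 0 = {{#} :: 'n multiset}" by (auto simp: symbasis_def)
  then show ?case by (intro exI[of _ "\<lambda>_. 1"]) simp
next
  case (add j M)
  then obtain c where c: "\<And>v. mon_eval M (vmul v g) = (\<Sum>N\<in>symbasis (size M). c N * mon_eval N v)" by blast
  have shift: "(\<Sum>N\<in>symbasis (size M). c N * (v i * mon_eval N v)) =
      (\<Sum>N\<in>symbasis (Suc (size M)). if i \<in># N then c (N - {#i#}) * mon_eval N v else 0)" for i v
  proof -
    have "(\<Sum>N\<in>symbasis (size M). c N * (v i * mon_eval N v)) =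
        (\<Sum>N\<in>{N \<in> symbasis (Suc (size M)). i \<in># N}. c (N - {#i#}) * mon_eval N v)"
      by (rule sum.reindex_bij_witness[of _ "\<lambda>N. N - {#i#}" "add_mset i"])
        (auto simp: symbasis_def size_Diff_singleton)
    then show ?thesis by (simp add: sum.inter_filter)
  qed
  have "mon_eval (add_mset j M) (vmul v g) =
      (\<Sum>N\<in>symbasis (Suc (size M)). (\<Sum>i\<in>UNIV. g $ i $ j * (if i \<in># N then c (N - {#i#}) else 0)) * mon_eval N v)" for v
  proof -
    have "mon_eval (add_mset j M) (vmul v g) =
        (\<Sum>i\<in>UNIV. g $ i $ j * (\<Sum>N\<in>symbasis (size M). c N * (v i * mon_eval N v)))"
      unfolding mon_eval_simps c vmul_def sum_distrib_left sum_distrib_right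
      by (subst sum.swap) (simp add: mult_ac)
    also have "\<dots> = (\<Sum>i\<in>UNIV. \<Sum>N\<in>symbasis (Suc (size M)).
        g $ i $ j * (if i \<in># N then c (N - {#i#}) else 0) * mon_eval N v)"
      unfolding shift sum_distrib_left by (intro sum.cong refl) auto
    also have "\<dots> = (\<Sum>N\<in>symbasis (Suc (size M)). \<Sum>i\<in>UNIV.
        g $ i $ j * (if i \<in># N then c (N - {#i#}) else 0) * mon_eval N v)" by (rule sum.swap)
    finally show ?thesis by (simp only: sum_distrib_right)
  qed
  then show ?case by (intro exI) auto
qed

text \<open>The product rule. For i outside \<open>M\<close> the factor \<open>count M i = 0\<close>
  hides that \<open>M - {#i#}\<close> removes nothing.\<close>

lemma dmon_eval_add_mset: "dmon_eval (add_mset j M) v w = w j * mon_eval M v + v j * dmon_eval M v w"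
proof -
  have "of_nat (count (add_mset j M) i) * w i * mon_eval (add_mset j M - {#i#}) v =
      (if i = j then w j * mon_eval M v else 0) + v j * (of_nat (count M i) * w i * mon_eval (M - {#i#}) v)" for i
    by (cases "i \<in># M") (auto simp: not_in_iff algebra_simps insert_DiffM2 dest!: multi_member_split)
  then show ?thesis
    unfolding dmon_eval_def sum_distrib_left by (simp add: sum.distrib sum.delta)
qed

lemma mon_eval_has_field_derivative:
  "((\<lambda>t. mon_eval M (\<lambda>i. v i + t * w i)) has_field_derivative dmon_eval M v w) (at 0)"
proof (induction M)
  case empty
  then show ?case by (simp add: dmon_eval_def)
next
  case (add j M)
  have "((\<lambda>t. v j + t * w j) has_field_derivative w j) (at 0)"
    by (auto intro!: derivative_eq_intros)
  from DERIV_mult[OF this add] show ?case by (simp add: dmon_eval_add_mset add.commute mult.commute)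
qed

text \<open>Column M of the representing matrix, read as a polynomial in v, is the image of the
  monomial under the derivation with e_j \<mapsto> X(e_j), hence its derivative along v X.\<close>

lemma sum_sym_rep_mon_eval:
  assumes "M \<in> symbasis d"
  shows "(\<Sum>N\<in>symbasis d. sym_rep X N M * mon_eval N v) = dmon_eval M v (vmul v X)"
proof -
  have "(\<Sum>N\<in>symbasis d. sym_rep X N M * mon_eval N v) =
    (\<Sum>N\<in>symbasis d. \<Sum>j\<in>UNIV. \<Sum>i\<in>UNIV. of_nat (count M j) * X $ i $ j *
      (if N = M - {#j#} + {#i#} then mon_eval N v else 0))"
    unfolding sym_rep_def sum_distrib_left sum_distrib_right by (intro sum.cong refl) auto
  also have "\<dots> = (\<Sum>j\<in>UNIV. \<Sum>N\<in>symbasis d. \<Sum>i\<in>UNIV. of_nat (count M j) * X $ i $ j *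
      (if N = M - {#j#} + {#i#} then mon_eval N v else 0))"
    by (rule sum.swap)
  also have "\<dots> = (\<Sum>j\<in>UNIV. \<Sum>i\<in>UNIV. \<Sum>N\<in>symbasis d. of_nat (count M j) * X $ i $ j *
      (if N = M - {#j#} + {#i#} then mon_eval N v else 0))"
    by (rule sum.cong[OF refl], rule sum.swap)
  also have "\<dots> = (\<Sum>j\<in>UNIV. \<Sum>i\<in>UNIV. of_nat (count M j) * X $ i $ j * (v i * mon_eval (M - {#j#}) v))"
  proof (rule sum.cong[OF refl], rule sum.cong[OF refl])
    fix i j
    show "(\<Sum>N\<in>symbasis d. of_nat (count M j) * X $ i $ j *
        (if N = M - {#j#} + {#i#} then mon_eval N v else 0)) =
      of_nat (count M j) * X $ i $ j * (v i * mon_eval (M - {#j#}) v)"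
    proof (cases "j \<in># M")
      case True
      then have "size (M - {#j#} + {#i#}) = size M" by (simp add: size_Suc_Diff1)
      then have "M - {#j#} + {#i#} \<in> symbasis d" using assms by (simp add: symbasis_def)
      then show ?thesis by (simp add: sum_distrib_left[symmetric] sum.delta)
    qed (simp add: not_in_iff)
  qed
  also have "\<dots> = dmon_eval M v (vmul v X)"
    unfolding dmon_eval_def vmul_def sum_distrib_left sum_distrib_right by (simp add: mult_ac)
  finally show ?thesis .
qed

lemma vmul_mult: "vmul v (X ** Y) = vmul (vmul v X) Y"
proof
  fix j
  have "vmul v (X ** Y) j = (\<Sum>i\<in>UNIV. \<Sum>k\<in>UNIV. v i * X $ i $ k * Y $ k $ j)"
    by (simp add: vmul_def matrix_matrix_mult_def sum_distrib_left mult.assoc)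
  also have "\<dots> = (\<Sum>k\<in>UNIV. \<Sum>i\<in>UNIV. v i * X $ i $ k * Y $ k $ j)" by (rule sum.swap)
  also have "\<dots> = vmul (vmul v X) Y j" by (simp add: vmul_def sum_distrib_right)
  finally show "vmul v (X ** Y) j = vmul (vmul v X) Y j" .
qed

lemma vmul_one: "vmul v (Finite_Cartesian_Product.mat 1) = v"
  by (simp add: fun_eq_iff vmul_def Finite_Cartesian_Product.mat_def if_distrib[of "\<lambda>x. _ * x"] sum.delta' cong: if_cong)

text \<open>The matrix T g of the substitution v \<mapsto> v g on degree d monomials intertwines the two representations:
  the Lie algebra acts on monomials as a directional derivative, to which the chain rule applies.\<close>
lemma minor_sum_sym_rep_conj:
  fixes P Q X :: "complex^'n::finite^'n"
  assumes PQ: "P ** Q = Finite_Cartesian_Product.mat 1" "Q ** P = Finite_Cartesian_Product.mat 1"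
    and k: "k \<le> card (symbasis d :: 'n multiset set)"
  shows "minor_sum (symbasis d) k (sym_rep (P ** X ** Q)) = minor_sum (symbasis d) k (sym_rep X)"
proof -
  have "\<exists>T. \<forall>M\<in>symbasis d. \<forall>v. mon_eval M (vmul v g) = (\<Sum>N\<in>symbasis d. T N M * mon_eval N v)"
    for g :: "complex^'n^'n"
  proof -
    obtain c where "\<And>M v. mon_eval M (vmul v g) = (\<Sum>N\<in>symbasis (size M). c M N * mon_eval N v)"
      using mon_eval_vmul[of _ g] by metis
    then show ?thesis by (intro exI[of _ "\<lambda>N M. c M N"]) (simp add: symbasis_def)
  qed
  then obtain T where T: "\<And>(g::complex^'n^'n) M v. M \<in> symbasis d \<Longrightarrow>
      mon_eval M (vmul v g) = (\<Sum>N\<in>symbasis d. T g N M * mon_eval N v)"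
    by metis
  \<comment> \<open>Differentiate the defining identity of T along v + t w at t = 0, using that v
    \<mapsto> v g is linear.\<close>
  have dT: "dmon_eval M (vmul v g) (vmul w g) = (\<Sum>N\<in>symbasis d. T g N M * dmon_eval N v w)"
    if "M \<in> symbasis d" for g M v w
  proof (rule DERIV_unique)
    have "vmul (\<lambda>i. v i + t * w i) g = (\<lambda>i. vmul v g i + t * vmul w g i)" for t
      by (simp add: fun_eq_iff vmul_def sum_distrib_left sum.distrib algebra_simps)
    then show "((\<lambda>t. mon_eval M (vmul (\<lambda>i. v i + t * w i) g)) has_field_derivative
        dmon_eval M (vmul v g) (vmul w g)) (at 0)"
      by (simp add: mon_eval_has_field_derivative)
    show "((\<lambda>t. mon_eval M (vmul (\<lambda>i. v i + t * w i) g)) has_field_derivative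
        (\<Sum>N\<in>symbasis d. T g N M * dmon_eval N v w)) (at 0)"
      unfolding T[OF that] by (intro DERIV_sum DERIV_cmult mon_eval_has_field_derivative)
  qed
  show ?thesis
  proof (rule minor_sum_similar[where T = "T P" and S = "T Q"])
    fix K M :: "'n multiset" assume KM: "K \<in> symbasis d" "M \<in> symbasis d"
    show "(\<Sum>N\<in>symbasis d. sym_rep (P ** X ** Q) K N * T P N M) =
        (\<Sum>N\<in>symbasis d. T P K N * sym_rep X N M)"
    \<comment> \<open>Matrix entries are compared as coefficients of polynomials in v: both sides
      become the derivative of the monomial M at v P along v P X.\<close>
    proof (rule mon_eval_independent_eq[OF _ KM(1)])
      fix v
      have "(\<Sum>K\<in>symbasis d. (\<Sum>N\<in>symbasis d. sym_rep (P ** X ** Q) K N * T P N M) * mon_eval K v) =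
          (\<Sum>N\<in>symbasis d. T P N M * (\<Sum>K\<in>symbasis d. sym_rep (P ** X ** Q) K N * mon_eval K v))"
        unfolding sum_distrib_left sum_distrib_right by (subst sum.swap) (simp add: mult_ac)
      also have "\<dots> = (\<Sum>N\<in>symbasis d. T P N M * dmon_eval N v (vmul v (P ** X ** Q)))"
        by (simp add: sum_sym_rep_mon_eval)
      also have "\<dots> = dmon_eval M (vmul v P) (vmul (vmul v (P ** X ** Q)) P)" by (rule dT[OF KM(2), symmetric])
      also have "vmul (vmul v (P ** X ** Q)) P = vmul (vmul v P) X"
        unfolding vmul_mult[symmetric] matrix_mul_assoc[symmetric] PQ by simp
      also have "dmon_eval M (vmul v P) (vmul (vmul v P) X) = (\<Sum>N\<in>symbasis d. sym_rep X N M * mon_eval N (vmul v P))"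
        by (rule sum_sym_rep_mon_eval[OF KM(2), symmetric])
      also have "\<dots> = (\<Sum>N\<in>symbasis d. sym_rep X N M * (\<Sum>K\<in>symbasis d. T P K N * mon_eval K v))"
        by (simp add: T)
      also have "\<dots> = (\<Sum>K\<in>symbasis d. (\<Sum>N\<in>symbasis d. T P K N * sym_rep X N M) * mon_eval K v)"
        unfolding sum_distrib_left sum_distrib_right by (subst sum.swap) (simp add: mult_ac)
      finally show "(\<Sum>K\<in>symbasis d. (\<Sum>N\<in>symbasis d. sym_rep (P ** X ** Q) K N * T P N M) * mon_eval K v) =
          (\<Sum>K\<in>symbasis d. (\<Sum>N\<in>symbasis d. T P K N * sym_rep X N M) * mon_eval K v)" .
    qed
    show "(\<Sum>N\<in>symbasis d. T Q K N * T P N M) = (if K = M then 1 else 0)"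
    \<comment> \<open>The composite of the two substitutions is v \<mapsto> v Q P = v.\<close>
    proof (rule mon_eval_independent_eq[OF _ KM(1)])
      fix v
      have "(\<Sum>K\<in>symbasis d. (\<Sum>N\<in>symbasis d. T Q K N * T P N M) * mon_eval K v) =
          (\<Sum>N\<in>symbasis d. T P N M * (\<Sum>K\<in>symbasis d. T Q K N * mon_eval K v))"
        unfolding sum_distrib_left sum_distrib_right by (subst sum.swap) (simp add: mult_ac)
      also have "\<dots> = (\<Sum>N\<in>symbasis d. T P N M * mon_eval N (vmul v Q))" by (simp add: T)
      also have "\<dots> = mon_eval M (vmul (vmul v Q) P)" by (rule T[OF KM(2), symmetric])
      also have "\<dots> = mon_eval M v" unfolding vmul_mult[symmetric] PQ vmul_one ..
      also have "\<dots> = (\<Sum>K\<in>symbasis d. (if K = M then 1 else 0) * mon_eval K v)"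
        using KM(2) by (simp add: if_distrib[of "\<lambda>x. x * _"] sum.delta cong: if_cong)
      finally show "(\<Sum>K\<in>symbasis d. (\<Sum>N\<in>symbasis d. T Q K N * T P N M) * mon_eval K v) =
          (\<Sum>K\<in>symbasis d. (if K = M then 1 else 0) * mon_eval K v)" .
    qed
  qed (use k in auto)
qed

section \<open>Coefficients for the symmetric power: invariance and restriction to the
  diagonal\<close>

lemma sym_coeff_eq_minor_sum:
  assumes "k \<le> card (symbasis d :: 'n::finite multiset set)"
  shows "sym_coeff d k (X :: complex^'n^'n) = minor_sum (symbasis d) k (sym_rep X)"
  using coeff_det_on_char_mat[OF finite_symbasis assms]
  by (simp add: sym_coeff_def sym_charpoly_def char_mat_def[abs_def])

lemma sym_coeff_conj_invariant:
  assumes k: "k \<le> card (symbasis d :: 'n::finite multiset set)"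
  shows "(sym_coeff d k :: complex^'n^'n \<Rightarrow> complex) \<in> conj_invariants"
proof (rule conj_invariantsI)
  have "(\<lambda>X::complex^'n^'n. sym_rep X N M) \<in> poly_funs" for N M
    unfolding sym_rep_def poly_funs_def
    by (intro alg_gen_sum alg_gen_smult alg_gen.mult alg_gen.const coord_in_poly_funs[unfolded poly_funs_def])
  then have "(\<lambda>X::complex^'n^'n. minor_sum (symbasis d) k (sym_rep X)) \<in> poly_funs"
    unfolding poly_funs_def by (intro minor_sum_in_alg_gen)
  then show "(sym_coeff d k :: complex^'n^'n \<Rightarrow> complex) \<in> poly_funs"
    by (simp add: sym_coeff_eq_minor_sum[OF k, abs_def])
qed (simp add: sym_coeff_eq_minor_sum[OF k] minor_sum_sym_rep_conj k)

lemma weight_eq_sum: "weight l M = (\<Sum>j\<in>(UNIV::'n::finite set). of_nat (count M j) * l j)"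
proof (induction M)
  case (add i M)
  have "of_nat (count (add_mset i M) j) * l j = (if j = i then l j else 0) + of_nat (count M j) * l j" for j
    by (simp add: distrib_right)
  then show ?case using add by (simp add: weight_def sum.distrib sum.delta)
qed (simp add: weight_def)

text \<open>Only i = j survives in the action of a diagonal matrix, so each monomial is an
  eigenvector; indices j outside \<open>M\<close> drop out by their zero multiplicity.\<close>

lemma sym_rep_diagm: "sym_rep (diagm l) N M = (if N = M then weight l N else 0)"
proof -
  have "of_nat (count M j) * (\<Sum>i\<in>UNIV. diagm l $ i $ j * (if N = M - {#j#} + {#i#} then 1 else 0)) =
      (if N = M then of_nat (count M j) * l j else 0)" for j
    by (cases "j \<in># M")
      (auto simp: diagm_nth not_in_iff if_distrib[of "\<lambda>x. x * _"] sum.delta cong: if_cong)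
  then show ?thesis by (simp add: sym_rep_def weight_eq_sum)
qed

lemma sym_coeff_diagm:
  assumes "k \<le> card (symbasis d :: 'n::finite multiset set)"
  shows "sym_coeff d k (diagm l :: complex^'n^'n) = esym (symbasis d) k (weight l)"
  unfolding sym_coeff_eq_minor_sum[OF assms] by (rule minor_sum_diagonal) (auto simp: sym_rep_diagm)

section \<open>Three generating sets of the invariant ring\<close>

theorem theorem1p2:
  fixes d :: nat
  assumes "CARD('n::finite) \<ge> 2" and "d \<ge> 1"
  shows "coeff_algebra_sym d = (conj_invariants :: (complex^'n^'n \<Rightarrow> complex) set)
    \<and> (conj_invariants :: (complex^'n^'n \<Rightarrow> complex) set)
        = alg_gen {princ_minor_sum i | i. 1 \<le> i \<and> i \<le> CARD('n)}
    \<and> (conj_invariants :: (complex^'n^'n \<Rightarrow> complex) set)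
        = alg_gen {power_trace i | i. 1 \<le> i \<and> i \<le> CARD('n)}"
proof (intro conjI)
  let ?D = "\<lambda>f :: complex^'n^'n \<Rightarrow> complex. f \<circ> diagm"
  show "coeff_algebra_sym d = (conj_invariants :: (complex^'n^'n \<Rightarrow> complex) set)"
    unfolding coeff_algebra_sym_def
  proof (rule alg_gen_eq_conj_invariants)
    let ?S = "{sym_coeff d k | k. 1 \<le> k \<and> k \<le> card (symbasis d :: 'n multiset set)} :: (complex^'n^'n \<Rightarrow> complex) set"
    show "?S \<subseteq> conj_invariants" using sym_coeff_conj_invariant by blast
    show "psum UNIV k \<in> alg_gen (?D ` ?S)" for k
    proof (rule psum_in_alg_gen_esym_symbasis[OF assms(2)])
      fix j assume j: "1 \<le> j" "j \<le> card (symbasis d :: 'n multiset set)"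
      then have "(\<lambda>l. esym (symbasis d :: 'n multiset set) j (weight l)) = ?D (sym_coeff d j)"
        by (auto simp: sym_coeff_diagm)
      then show "(\<lambda>l. esym (symbasis d :: 'n multiset set) j (weight l)) \<in> alg_gen (?D ` ?S)"
        using j by (auto intro!: alg_gen.gen)
    qed
  qed
  show "conj_invariants = alg_gen ({princ_minor_sum i | i. 1 \<le> i \<and> i \<le> CARD('n)} :: (complex^'n^'n \<Rightarrow> complex) set)"
  proof (rule alg_gen_eq_conj_invariants[symmetric])
    let ?S = "{princ_minor_sum i | i. 1 \<le> i \<and> i \<le> CARD('n)} :: (complex^'n^'n \<Rightarrow> complex) set"
    show "?S \<subseteq> conj_invariants" using princ_minor_sum_conj_invariant by blast
    have "esym UNIV j \<in> alg_gen (?D ` ?S)" if "1 \<le> j" "j \<le> CARD('n)" for j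
    proof -
      have "esym UNIV j = ?D (princ_minor_sum j)" by (auto simp: princ_minor_sum_diagm)
      then show ?thesis using that by (auto intro!: alg_gen.gen)
    qed
    then show "psum UNIV k \<in> alg_gen (?D ` ?S)" for k
      using psum_in_alg_gen[of "UNIV :: 'n set" "\<lambda>i l. l i" "?D ` ?S" k] by simp
  qed
  show "conj_invariants = alg_gen ({power_trace i | i. 1 \<le> i \<and> i \<le> CARD('n)} :: (complex^'n^'n \<Rightarrow> complex) set)"
  proof (rule alg_gen_eq_conj_invariants[symmetric])
    let ?S = "{power_trace i | i. 1 \<le> i \<and> i \<le> CARD('n)} :: (complex^'n^'n \<Rightarrow> complex) set"
    show "?S \<subseteq> conj_invariants" using power_trace_conj_invariant by blast
    have p: "psum UNIV j \<in> alg_gen (?D ` ?S)" if "1 \<le> j" "j \<le> CARD('n)" for j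
    proof -
      have "psum UNIV j = ?D (power_trace j)" by (auto simp: power_trace_diagm)
      then show ?thesis using that by (auto intro!: alg_gen.gen)
    qed
    \<comment> \<open>Power sums of degree above n are reached through e_1, ..., e_n, which the
      first n power sums generate.\<close>
    have "esym UNIV j \<in> alg_gen (?D ` ?S)" if "j \<le> CARD('n)" for j
      using esym_in_alg_gen[of "UNIV :: 'n set" j "\<lambda>i l. l i" "?D ` ?S"] p that by simp
    then show "psum UNIV k \<in> alg_gen (?D ` ?S)" for k
      using psum_in_alg_gen[of "UNIV :: 'n set" "\<lambda>i l. l i" "?D ` ?S" k] by simp
  qed
qed

end
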